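(* Let $f=h+\overline g$ be a locally univalent harmonic mapping defined in the unit disk $\mathbb D$. (i) If $f$ is an $\mathcal{SHU}$ mapping, then $\|S_f\|\le 6$. (ii) If $f$ is an $\mathcal{SHC}$ mapping, then $\|S_f\|\le 2$. Both constants are sharp (that is, neither $6$ in (i) nor $2$ in (ii) can be replaced by a smaller number).
   Context: $\mathbb D$ is the open unit disk in $\mathbb C$. A harmonic mapping $f$ in $\mathbb D$ is a complex-valued harmonic function; it has a canonical decomposition $f=h+\overline g$ with $h,g$ analytic in $\mathbb D$. It is (locally univalent and) sense-preserving if and only if $h'$ does not vanish and the dilatation $\omega=g'/h'$ satisfies $|\omega|<1$ in $\mathbb D$. For a locally univalent analytic function $h$, $Sh=(h''/h')'-\frac12(h''/h')^2$. For a sense-preserving harmonic mapping $f=h+\overline g$ in $\mathbb D$ with dilatation $\omega$, the Schwarzian derivative is $$S_f=Sh+\frac{\overline\omega}{1-|\omega|^2}\left(\frac{h''}{h'}\,\omega'-\omega''\right)-\frac32\left(\frac{\omega'\,\overline\omega}{1-|\omega|^2}\right)^2,$$ and the Schwarzian norm is $\|S_f\|=\sup_{z\in\mathbb D}|S_f(z)|(1-|z|^2)^2$. $\mathcal S_H$ is the family of sense-preserving univalent (i.e. injective) harmonic mappings $f=h+\overline g$ in $\mathbb D$ with $h(0)=g(0)=0$ and $h'(0)=1$. A function $f=h+\overline g\in\mathcal S_H$ is an $\mathcal{SHU}$ (stable harmonic univalent) mapping if $h+\lambda\overline g$ is univalent in $\mathbb D$ for every $\lambda\in\mathbb C$ with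 $|\lambda|=1$; it is an $\mathcal{SHC}$ (stable harmonic convex) mapping if $h+\lambda\overline g$ is convex (univalent in $\mathbb D$ with convex image) for every $|\lambda|=1$. *)

theory Defs
  imports "HOL-Complex_Analysis.Complex_Analysis"
begin

abbreviation unit_disk :: "complex set" where
  "unit_disk \<equiv> ball 0 1"

text \<open>
  A harmonic mapping \<open>f\<close> of the disk is carried together with the analytic functions
  \<open>h\<close>, \<open>g\<close> of its canonical decomposition, which are unique up to an additive constant.
\<close>

definition canonical_decomposition ::
  "(complex \<Rightarrow> complex) \<Rightarrow> (complex \<Rightarrow> complex) \<Rightarrow> (complex \<Rightarrow> complex) \<Rightarrow> bool" where
  "canonical_decomposition f h g \<longleftrightarrow>
     h holomorphic_on unit_disk \<and> g holomorphic_on unit_disk \<and>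
     (\<forall>z\<in>unit_disk. f z = h z + cnj (g z))"

definition locally_univalent :: "(complex \<Rightarrow> complex) \<Rightarrow> bool" where
  "locally_univalent f \<longleftrightarrow>
     (\<forall>z\<in>unit_disk. \<exists>U. open U \<and> z \<in> U \<and> inj_on f (U \<inter> unit_disk))"

definition dilatation :: "(complex \<Rightarrow> complex) \<Rightarrow> (complex \<Rightarrow> complex) \<Rightarrow> complex \<Rightarrow> complex" where
  "dilatation h g z = deriv g z / deriv h z"

text \<open>
  The condition says that the Jacobian \<open>\<bar>h'\<bar>\<^sup>2 - \<bar>g'\<bar>\<^sup>2\<close>
  of \<open>h + cnj g\<close> is positive.
\<close>

definition sense_preserving :: "(complex \<Rightarrow> complex) \<Rightarrow> (complex \<Rightarrow> complex) \<Rightarrow> bool" where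
  "sense_preserving h g \<longleftrightarrow>
     (\<forall>z\<in>unit_disk. deriv h z \<noteq> 0 \<and> cmod (dilatation h g z) < 1)"

definition schwarzian :: "(complex \<Rightarrow> complex) \<Rightarrow> complex \<Rightarrow> complex" where
  "schwarzian h z =
     deriv (\<lambda>w. deriv (deriv h) w / deriv h w) z - 1/2 * (deriv (deriv h) z / deriv h z)\<^sup>2"

definition harmonic_schwarzian ::
  "(complex \<Rightarrow> complex) \<Rightarrow> (complex \<Rightarrow> complex) \<Rightarrow> complex \<Rightarrow> complex" where
  "harmonic_schwarzian h g z =
     (let \<omega> = dilatation h g in
        schwarzian h z
        + cnj (\<omega> z) / (1 - (cmod (\<omega> z))\<^sup>2)
            * (deriv (deriv h) z / deriv h z * deriv \<omega> z - deriv (deriv \<omega>) z)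
        - 3/2 * (deriv \<omega> z * cnj (\<omega> z) / (1 - (cmod (\<omega> z))\<^sup>2))\<^sup>2)"

text \<open>The supremum is taken in the extended reals, so that it is infinite when unbounded.\<close>

definition schwarzian_norm :: "(complex \<Rightarrow> complex) \<Rightarrow> (complex \<Rightarrow> complex) \<Rightarrow> ereal" where
  "schwarzian_norm h g =
     (SUP z\<in>unit_disk. ereal (cmod (harmonic_schwarzian h g z) * (1 - (cmod z)\<^sup>2)\<^sup>2))"

definition class_SH ::
  "(complex \<Rightarrow> complex) \<Rightarrow> (complex \<Rightarrow> complex) \<Rightarrow> (complex \<Rightarrow> complex) \<Rightarrow> bool" where
  "class_SH f h g \<longleftrightarrow>
     canonical_decomposition f h g \<and> sense_preserving h g \<and> inj_on f unit_disk \<and>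
     h 0 = 0 \<and> g 0 = 0 \<and> deriv h 0 = 1"

definition SHU ::
  "(complex \<Rightarrow> complex) \<Rightarrow> (complex \<Rightarrow> complex) \<Rightarrow> (complex \<Rightarrow> complex) \<Rightarrow> bool" where
  "SHU f h g \<longleftrightarrow>
     class_SH f h g \<and>
     (\<forall>\<mu>. cmod \<mu> = 1 \<longrightarrow> inj_on (\<lambda>z. h z + \<mu> * cnj (g z)) unit_disk)"

definition SHC ::
  "(complex \<Rightarrow> complex) \<Rightarrow> (complex \<Rightarrow> complex) \<Rightarrow> (complex \<Rightarrow> complex) \<Rightarrow> bool" where
  "SHC f h g \<longleftrightarrow>
     class_SH f h g \<and>
     (\<forall>\<mu>. cmod \<mu> = 1 \<longrightarrow>
        inj_on (\<lambda>z. h z + \<mu> * cnj (g z)) unit_disk \<and>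
        convex ((\<lambda>z. h z + \<mu> * cnj (g z)) ` unit_disk))"

end

theory Submission
  imports Defs "HOL-Real_Asymp.Real_Asymp"
begin

text \<open>
  At each point the harmonic Schwarzian is the Schwarzian of an analytic function. For a complex number \<open>c\<close> with
  \<open>\<bar>c\<bar> \<le> 1\<close> the analytic function \<open>h + c g\<close> has derivative \<open>h' (1 + c \<omega>)\<close>, and its Schwarzian
  at a fixed point \<open>z\<close> is a rational function of \<open>c\<close> without poles in the closed unit disk.
  Its value at \<open>c = - cnj (\<omega> z)\<close> is exactly \<open>S\<^sub>f z\<close>. By the maximum principle in the variable \<open>c\<close>,
  a bound that holds at \<open>z\<close> for all \<open>\<bar>c\<bar> = 1\<close> therefore holds for \<open>S\<^sub>f\<close>
  (\<open>harmonic_schwarzian_bound\<close>).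

  So it remains to see that stability passes from \<open>h + \<mu> cnj g\<close> to \<open>h + c g\<close>. Univalence of the
  whole harmonic circle means that \<open>\<bar>h z - h w\<bar>\<close> and \<open>\<bar>g z - g w\<bar>\<close> are never equal for
  \<open>z \<noteq> w\<close>; near the diagonal the former is larger, hence it is larger everywhere
  (\<open>stable_univalent_strict\<close>). For convexity, \<open>h + c g\<close> and a suitable \<open>h + \<mu> cnj g\<close> differ by
  real multiples of any prescribed direction, so each chord of the image of \<open>h + c g\<close> is
  obtained from a chord of a convex set by sliding along that chord (\<open>stable_convex_analytic\<close>).

  What is left are two classical facts on an analytic univalent \<open>\<phi>\<close>: the quantity
  \<open>\<bar>S \<phi> z\<bar> (1 - \<bar>z\<bar>\<^sup>2)\<^sup>2\<close> is at most 6, and at most 2 if the image is convex. It is invariant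
  under disk automorphisms, so only \<open>z = 0\<close> matters. There \<open>S \<phi> 0 = - 6 b\<close>, where \<open>b\<close> is the
  coefficient of \<open>z\<close> in the expansion of \<open>\<phi>' 0 / (\<phi> z - \<phi> 0)\<close>, and \<open>\<bar>b\<bar> \<le> 1\<close> is the area
  theorem (\<open>area_theorem\<close>). In the convex case \<open>1 + z \<phi>''/\<phi>'\<close> has nonnegative real part
  (\<open>convex_univalent_positive_real_part\<close>), so \<open>\<phi>''/\<phi>' = 2 w / (1 - z w)\<close> with a function \<open>w\<close>
  bounded by 1, and \<open>S \<phi> 0 = 2 w' 0\<close>.

  The constants are attained at the origin, with \<open>g = 0\<close>, by the Koebe function and by the
  conformal map onto a strip.
\<close>

no_notation Formal_Power_Series.fps_nth (infixl \<open>$\<close> 75)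
hide_const (open) Polynomial.content

section \<open>The plane as a real vector space\<close>

text \<open>
  The change of variables formula for Lebesgue measure is about maps of \<open>real ^ 'n\<close>. The next two
  maps, inverse to each other, carry it over to the complex plane.
\<close>

definition vec_of :: "complex \<Rightarrow> real^2" where "vec_of z = vector [Re z, Im z]"
definition complex_of_vec :: "real^2 \<Rightarrow> complex" where "complex_of_vec x = Complex (x$1) (x$2)"

lemma vec_of_nth [simp]: "vec_of z $ 1 = Re z" "vec_of z $ 2 = Im z"
  by (simp_all add: vec_of_def)

lemma vec_of_inverse [simp]: "complex_of_vec (vec_of z) = z" "vec_of (complex_of_vec x) = x"
  by (simp_all add: complex_of_vec_def vec_eq_iff forall_2 complex_eq_iff)

lemma Re_Im_complex_of_vec [simp]: "Re (complex_of_vec x) = x$1" "Im (complex_of_vec x) = x$2"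
  by (simp_all add: complex_of_vec_def)

lemma norm_vec_of [simp]: "norm (vec_of z) = cmod z"
  by (simp add: norm_vec_def L2_set_def sum_2 cmod_def)

lemma linear_vec_of: "bounded_linear vec_of"
  by (rule linear_conv_bounded_linear[THEN iffD1], rule linearI)
     (simp_all add: vec_eq_iff forall_2)

lemma linear_complex_of_vec: "bounded_linear complex_of_vec"
  by (rule linear_conv_bounded_linear[THEN iffD1], rule linearI)
     (simp_all add: complex_eq_iff)

lemma det_real_linear:
  "det (matrix (\<lambda>x. vec_of (u * complex_of_vec x + v * cnj (complex_of_vec x)))) = (cmod u)\<^sup>2 - (cmod v)\<^sup>2"
  unfolding det_2 matrix_def
  by (simp add: axis_def cmod_power2) (simp add: power2_eq_square algebra_simps)

text \<open>
  Fubini, in the only form needed: the box in \<open>real ^ 2\<close> is reparametrized by the product box, whose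
  integral is the iterated one.
\<close>

lemma integral_vec_eq_iterated:
  fixes j :: "complex \<Rightarrow> real"
  assumes j: "continuous_on (cbox a b) j"
  shows "((\<lambda>x. j (complex_of_vec x)) has_integral
            integral {Re a..Re b} (\<lambda>s. integral {Im a..Im b} (\<lambda>t. j (Complex s t))))
         (cbox (vec_of a) (vec_of b))"
proof -
  define B where "B = cbox (Re a, Im a) (Re b, Im b)"
  have cont: "continuous_on B (\<lambda>p. j (Complex (fst p) (snd p)))"
    by (rule continuous_on_compose2[OF j])
       (auto simp: B_def in_cbox_complex_iff cbox_Pair_eq Complex_eq intro!: continuous_intros)
  have "((\<lambda>p. j (Complex (fst p) (snd p))) has_integral
        integral (cbox (Re a) (Re b)) (\<lambda>s. integral (cbox (Im a) (Im b)) (\<lambda>t. j (Complex s t)))) B"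
    using integral_prod_continuous[OF cont[unfolded B_def]] integrable_continuous[OF cont[unfolded B_def]]
    by (simp add: B_def has_integral_integrable_integral)
  then have "((\<lambda>x::real^2. j (Complex (fst (x$1,x$2)) (snd (x$1,x$2)))) has_integral
       (1/1) *\<^sub>R integral (cbox (Re a) (Re b)) (\<lambda>s. integral (cbox (Im a) (Im b)) (\<lambda>t. j (Complex s t))))
       ((\<lambda>p. vec_of (Complex (fst p) (snd p))) ` B)"
    unfolding B_def
  proof (intro has_integral_twiddle)
    have 1: "(\<lambda>x::real^2. (x$1, x$2)) ` cbox u v = cbox (u$1,u$2) (v$1,v$2)" for u v
    proof -
      have "(p, q) \<in> (\<lambda>x::real^2. (x$1, x$2)) ` cbox u v"
        if "(p, q) \<in> cbox (u$1,u$2) (v$1,v$2)" for p q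
        using that by (intro image_eqI[of _ _ "vec_of (Complex p q)"])
            (auto simp: mem_box_cart forall_2 cbox_Pair_eq)
      then show ?thesis by (auto simp: mem_box_cart forall_2 cbox_Pair_eq)
    qed
    then show "\<exists>w z. (\<lambda>x::real^2. (x$1, x$2)) ` cbox u v = cbox w z" for u v by blast
    show "content ((\<lambda>x::real^2. (x$1, x$2)) ` cbox u v) = 1 * content (cbox u v)" for u v
    proof -
      have "cbox u v = {} \<longleftrightarrow> v$1 < u$1 \<or> v$2 < u$2"
        unfolding interval_eq_empty_cart using forall_2[of "\<lambda>i. \<not> v$i < u$i"] by blast
      then show ?thesis
        by (auto simp: 1 content_Pair content_cbox_if_cart UNIV_2[THEN arg_cong[where f="prod _"]])
    qed
    have 2: "(\<lambda>p. vec_of (Complex (fst p) (snd p))) ` cbox u v = cbox (vec_of (Complex (fst u) (snd u))) (vec_of (Complex (fst v) (snd v)))"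
      for u v
    proof -
      have "x \<in> (\<lambda>p. vec_of (Complex (fst p) (snd p))) ` cbox u v"
        if "x \<in> cbox (vec_of (Complex (fst u) (snd u))) (vec_of (Complex (fst v) (snd v)))" for x
        using that
        by (intro image_eqI[of _ _ "(x$1,x$2)"]; cases u; cases v)
            (auto simp: mem_box_cart forall_2 cbox_Pair_eq vec_eq_iff)
      then show ?thesis by (cases u; cases v) (auto simp: mem_box_cart forall_2 cbox_Pair_eq)
    qed
    then show "\<exists>w z. (\<lambda>p. vec_of (Complex (fst p) (snd p))) ` cbox u v = cbox w z" for u v by blast
  qed (auto intro!: continuous_intros simp: vec_eq_iff forall_2)
  moreover have "(\<lambda>p. vec_of (Complex (fst p) (snd p))) ` B = cbox (vec_of a) (vec_of b)"
  proof -
    have "x \<in> (\<lambda>p. vec_of (Complex (fst p) (snd p))) ` B" if "x \<in> cbox (vec_of a) (vec_of b)" for x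
      using that
      by (intro image_eqI[of _ _ "(x$1,x$2)"]) (auto simp: mem_box_cart forall_2 cbox_Pair_eq vec_eq_iff B_def)
    then show ?thesis by (auto simp: mem_box_cart forall_2 cbox_Pair_eq B_def)
  qed
  ultimately show ?thesis
    by (simp add: complex_of_vec_def)
qed

text \<open>
  A real-linear map \<open>h \<mapsto> u h + v cnj h\<close> of the plane has determinant \<open>\<bar>u\<bar>\<^sup>2 - \<bar>v\<bar>\<^sup>2\<close>, so the iterated
  integral is the area of the image. Maps that are not analytic are allowed because the area
  theorem will be applied to an analytic function followed by a real-linear map.
\<close>

lemma planar_area_bound:
  fixes f u v :: "complex \<Rightarrow> complex"
  assumes der: "\<And>x. x \<in> box a b \<Longrightarrow> (f has_derivative (\<lambda>h. u x * h + v x * cnj h)) (at x)"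
    and inj: "inj_on f (box a b)"
    and cont: "continuous_on (cbox a b) u" "continuous_on (cbox a b) v"
    and bound: "f ` box a b \<subseteq> cball 0 R" and "0 \<le> R"
  shows "integral {Re a..Re b} (\<lambda>s. integral {Im a..Im b}
           (\<lambda>t. \<bar>(cmod (u (Complex s t)))\<^sup>2 - (cmod (v (Complex s t)))\<^sup>2\<bar>)) \<le> pi * R\<^sup>2"
proof -
  define j where "j x = \<bar>(cmod (u x))\<^sup>2 - (cmod (v x))\<^sup>2\<bar>" for x
  define I where "I = integral {Re a..Re b} (\<lambda>s. integral {Im a..Im b} (\<lambda>t. j (Complex s t)))"
  define F where "F x = vec_of (f (complex_of_vec x))" for x
  define F' where "F' x k = vec_of (u (complex_of_vec x) * complex_of_vec k + v (complex_of_vec x) * cnj (complex_of_vec k))"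
    for x k
  define S where "S = box (vec_of a) (vec_of b)"
  have S_iff: "x \<in> S \<longleftrightarrow> complex_of_vec x \<in> box a b" for x
    by (simp add: S_def mem_box_cart forall_2 in_box_complex_iff)
  have "((\<lambda>x. j (complex_of_vec x)) has_integral I) (cbox (vec_of a) (vec_of b))"
    unfolding I_def
    by (rule integral_vec_eq_iterated) (unfold j_def, intro continuous_intros cont)
  then have int: "((\<lambda>x. \<bar>det (matrix (F' x))\<bar>) has_integral I) S"
    unfolding has_integral_open_interval S_def F'_def det_real_linear j_def .
  have d: "(F has_derivative F' x) (at x within S)" if "x \<in> S" for x
    unfolding F_def F'_def using that
    by (intro bounded_linear.has_derivative[OF linear_vec_of] has_derivative_at_withinI[OF 
          has_derivative_compose[OF bounded_linear_imp_has_derivative[OF linear_complex_of_vec] der]])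
       (simp add: S_iff)
  have inj': "inj_on F S"
  proof (rule inj_onI)
    fix x y assume *: "x \<in> S" "y \<in> S" "F x = F y"
    then have "f (complex_of_vec x) = f (complex_of_vec y)"
      unfolding F_def by (metis vec_of_inverse(1))
    then have "complex_of_vec x = complex_of_vec y"
      using inj * by (simp add: S_iff inj_on_eq_iff)
    then show "x = y" by (metis vec_of_inverse(2))
  qed
  have "measure lebesgue (F ` S) = I"
    using measure_differentiable_image_eq[OF _ d inj' has_integral_integrable[OF int]] int 
    by (auto simp: S_def integral_unique)
  moreover have "measure lebesgue (F ` S) \<le> measure lebesgue (cball (0::real^2) R)"
  proof (rule measure_mono_fmeasurable)
    show "F ` S \<subseteq> cball 0 R" using bound by (auto simp: F_def S_iff image_subset_iff)
    show "F ` S \<in> sets lebesgue"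
      using measurable_differentiable_image_eq[OF _ d inj'] has_integral_integrable[OF int] 
      by (auto simp: S_def fmeasurable_def)
  qed auto
  moreover have "measure lebesgue (cball (0::real^2) R) = pi * R\<^sup>2"
    using content_cball[OF \<open>0 \<le> R\<close>, of "0::real^2"] by (simp add: unit_ball_vol_2)
  ultimately show ?thesis by (simp add: I_def j_def)
qed

section \<open>The area theorem\<close>

text \<open>
  The image of the small punctured disk is open, and outside \<open>K\<close> it is also relatively closed, since
  \<open>F\<close> tends to infinity at 0 and the circle lands in \<open>K\<close>. The complement of \<open>K\<close> is connected,
  so the image covers it, and injectivity leaves no room there for points with
  \<open>\<bar>z\<bar> \<ge> \<rho>\<close>. This replaces an appeal to the Jordan curve theorem.
\<close>

lemma punctured_disk_image_inside_convex:
  fixes F :: "complex \<Rightarrow> complex"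
  assumes holo: "F holomorphic_on (ball 0 1 - {0})" and inj: "inj_on F (ball 0 1 - {0})"
    and pole: "filterlim F at_infinity (at 0)"
    and \<rho>: "0 < \<rho>" "\<rho> < 1"
    and K: "convex K" "bounded K" "F ` sphere 0 \<rho> \<subseteq> K"
    and z: "\<rho> \<le> cmod z" "cmod z < 1"
  shows "F z \<in> K"
proof -
  define A where "A = ball 0 \<rho> - {0::complex}"
  have A_sub: "A \<subseteq> ball 0 1 - {0}" using \<rho> by (auto simp: A_def)
  have open_FA: "open (F ` A)"
    by (intro open_mapping_thm3 holomorphic_on_subset[OF holo] inj_on_subset[OF inj] A_sub)
       (simp add: A_def open_delete)
  have closed_in: "F ` A \<inter> - K = F ` (cball 0 \<rho> - {0}) \<inter> - K"
  proof -
    have "cball 0 \<rho> - {0} = A \<union> sphere 0 \<rho>" using \<rho> by (auto simp: A_def)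
    then show ?thesis using K(3) by auto
  qed
  have closed: "closed (F ` (cball 0 \<rho> - {0}))"
    unfolding closed_sequential_limits
  proof (intro allI impI, elim conjE)
    fix x l assume x: "\<forall>n. x n \<in> F ` (cball 0 \<rho> - {0})" and l: "x \<longlonglongrightarrow> l"
    then obtain w where w: "\<And>n. w n \<in> cball 0 \<rho> - {0}" "\<And>n. x n = F (w n)"
      unfolding image_iff by metis
    obtain B where B: "\<And>n. cmod (x n) \<le> B"
      using convergent_imp_bounded[OF l] unfolding bounded_iff by auto
    obtain d where d: "d > 0" "\<And>u. u \<noteq> 0 \<Longrightarrow> cmod u < d \<Longrightarrow> cmod (F u) > B"
    proof -
      have "eventually (\<lambda>u. cmod (F u) > B) (at 0)"
        using filterlim_at_infinity_imp_norm_at_top[OF pole] by (simp add: filterlim_at_top_dense)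
      then show ?thesis using that unfolding eventually_at by auto
    qed
    have "w n \<in> cball 0 \<rho> - ball 0 d" for n
      using w B d by (metis Diff_iff insertI1 linorder_not_le mem_ball_0)
    moreover have "compact (cball 0 \<rho> - ball (0::complex) d)"
      by (simp add: compact_diff)
    ultimately obtain c r where r: "c \<in> cball 0 \<rho> - ball 0 d" "strict_mono r" "(w \<circ> r) \<longlonglongrightarrow> c"
      unfolding compact_def by blast
    have c: "c \<in> ball 0 1 - {0}" using r d \<rho> by auto
    have "continuous_on (ball 0 1 - {0}) F" by (rule holomorphic_on_imp_continuous_on[OF holo])
    then have "isCont F c"
      using c by (simp add: continuous_on_eq_continuous_at open_delete)
    then have "(\<lambda>n. F ((w \<circ> r) n)) \<longlonglongrightarrow> F c" 
      using r(3) by (rule isCont_tendsto_compose)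
    moreover have "(\<lambda>n. F ((w \<circ> r) n)) \<longlonglongrightarrow> l"
      using LIMSEQ_subseq_LIMSEQ[OF l r(2)] w(2) by (simp add: o_def)
    ultimately have "l = F c" using LIMSEQ_unique by blast
    then show "l \<in> F ` (cball 0 \<rho> - {0})" using r c by auto
  qed
  have conn: "connected (- K)" by (rule connected_complement_bounded_convex) (use K in auto)
  have ne: "F ` A \<inter> - K \<noteq> {}"
  proof -
    obtain B where B: "\<And>u. u \<in> K \<Longrightarrow> cmod u \<le> B" using K(2) unfolding bounded_iff by auto
    have "eventually (\<lambda>u. cmod (F u) > B) (at 0)"
      using filterlim_at_infinity_imp_norm_at_top[OF pole] by (simp add: filterlim_at_top_dense)
    moreover have "eventually (\<lambda>u. u \<in> A) (at 0)"
      unfolding eventually_at A_def using \<rho> by auto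
    ultimately have "eventually (\<lambda>u. u \<in> A \<and> cmod (F u) > B) (at 0)" by eventually_elim auto
    then obtain u where "u \<in> A" "cmod (F u) > B" 
      using eventually_happens[of _ "at (0::complex)"] by auto
    then show ?thesis using B by force
  qed
  have sub: "- K \<subseteq> F ` A"
  proof -
    have "- K \<subseteq> F ` A \<union> - F ` (cball 0 \<rho> - {0})" using closed_in by auto
    moreover have "F ` A \<inter> - F ` (cball 0 \<rho> - {0}) \<inter> - K = {}" using closed_in by auto
    ultimately have "F ` A \<inter> - K = {} \<or> - F ` (cball 0 \<rho> - {0}) \<inter> - K = {}"
      using connectedD[OF conn open_FA, of "- F ` (cball 0 \<rho> - {0})"] closed by auto
    then show ?thesis using ne closed_in by auto
  qed
  show ?thesis
  proof (rule ccontr)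
    assume "F z \<notin> K"
    then obtain a where "a \<in> A" "F z = F a" using sub by auto
    moreover have "z \<in> ball 0 1 - {0}" using z \<rho> by auto
    ultimately have "z = a" using inj A_sub by (meson inj_onD subsetD)
    then show False using z \<open>a \<in> A\<close> by (auto simp: A_def)
  qed
qed

lemma circle_mean_value:
  fixes m :: "complex \<Rightarrow> complex"
  assumes "m holomorphic_on ball 0 1" "0 < r" "r < 1"
  shows "((\<lambda>t. m (of_real r * cis t)) has_integral 2 * pi * m 0) {0..2*pi}"
proof -
  have "((\<lambda>u. m u / (u - 0)) has_contour_integral (2 * of_real pi * \<i> * m 0)) (circlepath 0 r)"
    by (intro Cauchy_integral_circlepath_simple holomorphic_on_subset[OF assms(1)]) (use assms in auto)
  then have "((\<lambda>t. m (0 + r * cis t) / (0 + r * cis t - 0) * r * \<i> * cis t) has_integral (2 * of_real pi * \<i> * m 0)) {0..2*pi}"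
    unfolding circlepath_def by (subst (asm) has_contour_integral_part_circlepath_iff) auto
  also have "(\<lambda>t. m (0 + r * cis t) / (0 + r * cis t - 0) * r * \<i> * cis t) = (\<lambda>t. \<i> * m (of_real r * cis t))"
    using assms by (auto simp: fun_eq_iff)
  finally have "((\<lambda>t. - \<i> * (\<i> * m (of_real r * cis t))) has_integral (- \<i> * (2 * of_real pi * \<i> * m 0))) {0..2*pi}"
    by (rule has_integral_mult_right)
  then show ?thesis by (simp add: algebra_simps)
qed

text \<open>
  Part of Parseval's identity, obtained without power series. With \<open>q = -1 + b z\<^sup>2\<close> one has
  \<open>\<bar>p\<bar>\<^sup>2 \<ge> \<bar>q\<bar>\<^sup>2 + 2 Re (cnj q (p - q))\<close>. On the circle \<open>cnj z = r\<^sup>2 / z\<close>, which turns the nonconstant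
  terms into the real part of a holomorphic function \<open>m\<close> with \<open>m 0 = 0\<close>; its mean vanishes.
\<close>

lemma circle_square_mean_ge:
  fixes l :: "complex \<Rightarrow> complex" and b :: complex
  assumes l: "l holomorphic_on ball 0 1" and r: "0 < r" "r < 1"
  defines "p \<equiv> \<lambda>z. -1 + b * z\<^sup>2 + z ^ 3 * l z"
  shows "integral {0..2*pi} (\<lambda>t. (cmod (p (of_real r * cis t)))\<^sup>2) \<ge> 2 * pi * (1 + (cmod b)\<^sup>2 * r ^ 4)"
proof -
  define m where "m z = 2 * (- b * z\<^sup>2 - z ^ 3 * l z + cnj b * r ^ 4 * z * l z)" for z
  have "((\<lambda>t. m (of_real r * cis t)) has_integral 2 * pi * m 0) {0..2*pi}"
    by (intro circle_mean_value) (use r in \<open>auto simp: m_def[abs_def] intro!: holomorphic_intros l\<close>)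
  then have "((\<lambda>t. Re (m (of_real r * cis t))) has_integral Re (2 * pi * m 0)) {0..2*pi}"
    by (rule has_integral_Re)
  then have "((\<lambda>t. (1 + (cmod b)\<^sup>2 * r ^ 4) + Re (m (of_real r * cis t))) has_integral 
              (1 + (cmod b)\<^sup>2 * r ^ 4) * (2 * pi) + 0) {0..2*pi}"
    using has_integral_const_real[of "1 + (cmod b)\<^sup>2 * r ^ 4" 0 "2*pi"]
    by (intro has_integral_add) (simp_all add: m_def mult_ac)
  moreover have "(\<lambda>t. (cmod (p (of_real r * cis t)))\<^sup>2) integrable_on {0..2*pi}"
    unfolding p_def using r
    by (intro integrable_continuous_real continuous_intros
         continuous_on_compose2[OF holomorphic_on_imp_continuous_on[OF l]]) (auto simp: norm_mult)
  moreover have "(1 + (cmod b)\<^sup>2 * r ^ 4) + Re (m z) \<le> (cmod (p z))\<^sup>2" if "cmod z = r" for z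
  proof -
    define q where "q = -1 + b * z\<^sup>2"
    define E where "E = z ^ 3 * l z"
    have zz: "z * cnj z = r\<^sup>2" using that by (metis complex_norm_square of_real_power)
    have 1: "(cmod (p z))\<^sup>2 = (cmod q)\<^sup>2 + 2 * Re (cnj q * E) + (cmod E)\<^sup>2"
      unfolding p_def q_def[symmetric] E_def[symmetric] cmod_power2
      by (simp add: power2_eq_square algebra_simps)
    have "cnj q * E = - (z ^ 3 * l z) + cnj b * (z * cnj z)\<^sup>2 * z * l z"
      unfolding q_def E_def by (simp add: algebra_simps power2_eq_square power3_eq_cube)
    then have 2: "cnj q * E = - (z ^ 3 * l z) + cnj b * r ^ 4 * z * l z"
      unfolding zz by simp
    have "complex_of_real ((cmod q)\<^sup>2) = q * cnj q" by (rule complex_norm_square)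
    also have "\<dots> = 1 - b * z\<^sup>2 - cnj (b * z\<^sup>2) + (b * cnj b) * (z * cnj z)\<^sup>2"
      unfolding q_def by (simp add: algebra_simps power2_eq_square)
    also have "\<dots> = of_real (1 + (cmod b)\<^sup>2 * r ^ 4) - (b * z\<^sup>2 + cnj (b * z\<^sup>2))"
      unfolding zz complex_norm_square[symmetric] using that by simp
    finally have 3: "(cmod q)\<^sup>2 = 1 + (cmod b)\<^sup>2 * r ^ 4 - 2 * Re (b * z\<^sup>2)"
      unfolding complex_add_cnj by (metis of_real_diff of_real_eq_iff)
    show ?thesis unfolding 1 2 3 m_def by simp
  qed
  ultimately show ?thesis using r
    by (intro has_integral_le[of "\<lambda>t. (1 + (cmod b)\<^sup>2 * r ^ 4) + Re (m (of_real r * cis t))", OF _ integrable_integral, simplified])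
       (auto simp: norm_mult mult_ac)
qed

text \<open>
  The image of the annulus between \<open>\<rho>\<close> and \<open>r\<close> is compared with what the circle of radius \<open>\<rho>\<close>
  encloses. To second order that curve is the ellipse traced by \<open>1/z + b z\<close>, and comparing with
  a disk would lose a constant. The real-linear map \<open>w \<mapsto> w - c cnj w\<close> with \<open>c = b \<rho>\<^sup>2\<close> turns the
  ellipse into a circle: on \<open>\<bar>z\<bar> = \<rho>\<close> the terms \<open>b z\<close> and \<open>c cnj (1/z)\<close> cancel exactly. The
  price is the determinant \<open>1 - \<bar>c\<bar>\<^sup>2\<close> on the left, which tends to 1 with \<open>\<rho>\<close>. Polar coordinates
  enter by composing with the exponential function, which keeps the map analytic.
\<close>

lemma area_inequality:
  fixes k :: "complex \<Rightarrow> complex" and b :: complex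
  defines "F \<equiv> \<lambda>z. 1 / z + b * z + z\<^sup>2 * k z"
  assumes k: "k holomorphic_on ball 0 1" and inj: "inj_on F (ball 0 1 - {0})"
    and \<rho>: "0 < \<rho>" "\<rho> < r" "r < 1" "cmod b * \<rho>\<^sup>2 < 1"
    and M: "0 \<le> M" "\<And>z. cmod z = \<rho> \<Longrightarrow> cmod (k z) \<le> M"
  shows "(1 - (cmod b * \<rho>\<^sup>2)\<^sup>2) * ((1/\<rho>\<^sup>2 - 1/r\<^sup>2) + (cmod b)\<^sup>2 * (r\<^sup>2 - \<rho>\<^sup>2)) \<le> (1/\<rho> + 2 * M * \<rho>\<^sup>2)\<^sup>2"
proof -
  \<comment> \<open>\<open>T\<close> straightens the ellipse; \<open>D\<close> is its determinant.\<close>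
  define c where "c = b * \<rho>\<^sup>2"
  define T where "T w = w - c * cnj w" for w
  define R where "R = 1/\<rho> + 2 * M * \<rho>\<^sup>2"
  define l where "l z = 2 * k z + z * deriv k z" for z
  define p where "p z = -1 + b * z\<^sup>2 + z ^ 3 * l z" for z
  define D where "D = 1 - (cmod c)\<^sup>2"
  have c1: "cmod c < 1" using \<rho> by (simp add: c_def norm_mult norm_power)
  have D0: "0 < D" using c1 by (simp add: D_def power_less_one_iff abs_square_less_1)
  have R0: "0 \<le> R" using \<rho> M by (simp add: R_def)
  have l_holo: "l holomorphic_on ball 0 1"
    unfolding l_def by (intro holomorphic_intros k) auto
  have F_holo: "F holomorphic_on ball 0 1 - {0}"
    unfolding F_def by (intro holomorphic_intros holomorphic_on_subset[OF k]) auto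
  have F_der: "(F has_field_derivative p z / z\<^sup>2) (at z)" if "z \<in> ball 0 1 - {0}" for z
  proof -
    have "(k has_field_derivative deriv k z) (at z)"
      by (rule holomorphic_derivI[OF k]) (use that in auto)
    then show ?thesis
      unfolding F_def p_def l_def using that
      by (auto intro!: derivative_eq_intros simp: field_simps power2_eq_square power3_eq_cube)
  qed
  have T_lin: "linear T"
    by (rule linearI) (simp_all add: T_def algebra_simps scaleR_conv_of_real)
  have T_low: "(1 - cmod c) * cmod w \<le> cmod (T w)" for w
    using norm_triangle_ineq2[of w "c * cnj w"] by (simp add: T_def norm_mult algebra_simps)
  have T_inj: "inj T"
  proof (rule linear_injective_0[OF T_lin, THEN iffD2], intro allI impI)
    fix w assume "T w = 0" then show "w = 0" using T_low[of w] c1 by (simp add: mult_le_0_iff)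
  qed
  define E where "E = T -` cball 0 R"
  have "convex E" unfolding E_def by (rule convex_linear_vimage[OF T_lin]) auto
  moreover have "bounded E"
    unfolding bounded_iff
  proof (intro exI ballI)
    fix w assume "w \<in> E"
    then have "(1 - cmod c) * cmod w \<le> R" using T_low[of w] by (simp add: E_def)
    then show "cmod w \<le> R / (1 - cmod c)" using c1 by (simp add: field_simps)
  qed
  moreover have "F ` sphere 0 \<rho> \<subseteq> E"
  proof
    fix w assume "w \<in> F ` sphere 0 \<rho>"
    then obtain z where z: "cmod z = \<rho>" and w: "w = F z" by auto
    then have z0: "z \<noteq> 0" using \<rho> by auto
    have zz: "z * cnj z = \<rho>\<^sup>2" using z by (metis complex_norm_square of_real_power)
    then have cz: "cnj z = \<rho>\<^sup>2 / z" using z0 by (simp add: field_simps)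
    have *: "T (F z) = (1 - cmod c ^ 2) / z + z\<^sup>2 * k z - c * cnj (z\<^sup>2 * k z)"
    proof -
      have "c * cnj (1 / z) = b * z" 
        unfolding c_def using z0 \<rho> by (simp add: cz field_simps)
      moreover have "c * cnj (b * z) = of_real (cmod c ^ 2) / z"
        using z0 complex_norm_square[of b]
        by (simp add: c_def norm_mult norm_power power_mult_distrib cz field_simps)
      moreover have "T (F z) = 1 / z + b * z + z\<^sup>2 * k z - (c * cnj (1/z) + c * cnj (b * z) + c * cnj (z\<^sup>2 * k z))"
        unfolding T_def F_def by (simp add: algebra_simps)
      ultimately show ?thesis by (simp add: diff_divide_distrib)
    qed
    have "cmod (T (F z)) \<le> D / \<rho> + \<rho>\<^sup>2 * M + cmod c * (\<rho>\<^sup>2 * M)"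
    proof -
      have "cmod (z\<^sup>2 * k z) \<le> \<rho>\<^sup>2 * M"
        using z M by (auto simp: norm_mult norm_power intro!: mult_left_mono)
      moreover from this have "cmod (c * cnj (z\<^sup>2 * k z)) \<le> cmod c * (\<rho>\<^sup>2 * M)"
        unfolding norm_mult complex_mod_cnj by (intro mult_left_mono) (auto simp: norm_mult)
      moreover have "cmod ((1 - cmod c ^ 2) / z) = D / \<rho>"
        using D0 z unfolding norm_divide by (metis D_def norm_of_real abs_of_pos of_real_1 of_real_diff of_real_power)
      ultimately show ?thesis unfolding * 
        by (smt (verit, best) norm_triangle_ineq norm_triangle_ineq4)
    qed
    also have "\<dots> \<le> 1 / \<rho> + \<rho>\<^sup>2 * M + 1 * (\<rho>\<^sup>2 * M)"
      using c1 \<rho> M by (intro add_mono divide_right_mono mult_right_mono) (auto simp: D_def)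
    finally show "w \<in> E" by (simp add: R_def E_def w)
  qed
  moreover have "filterlim F at_infinity (at 0)"
  proof -
    have "((\<lambda>z. b * z + z\<^sup>2 * k z) \<longlongrightarrow> b * 0 + 0\<^sup>2 * k 0) (at 0)"
      by (intro tendsto_intros isContD[of 0 k] holomorphic_on_imp_continuous_on[OF k, THEN continuous_on_interior]) auto
    moreover have "filterlim (\<lambda>z::complex. 1 / z) at_infinity (at 0)"
      unfolding inverse_eq_divide[symmetric] by (rule filterlim_inverse_at_infinity)
    ultimately have "filterlim (\<lambda>z. (b * z + z\<^sup>2 * k z) + 1 / z) at_infinity (at 0)"
      by (rule tendsto_add_filterlim_at_infinity)
    then show ?thesis by (simp add: F_def add_ac)
  qed
  ultimately have FE: "F z \<in> E" if "\<rho> \<le> cmod z" "cmod z < 1" for z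
    using punctured_disk_image_inside_convex[OF F_holo inj, of \<rho> E z] that \<rho> by auto
  \<comment> \<open>Logarithmic polar coordinates: the derivative of \<open>F (exp \<zeta>)\<close> is \<open>u\<close>, and \<open>T\<close> adds the part \<open>v\<close>.\<close>
  define f where "f \<zeta> = T (F (exp \<zeta>))" for \<zeta>
  define u where "u \<zeta> = p (exp \<zeta>) / exp \<zeta>" for \<zeta>
  define v where "v \<zeta> = - c * cnj (u \<zeta>)" for \<zeta>
  define lo where "lo = Complex (ln \<rho>) 0"
  define hi where "hi = Complex (ln r) (2 * pi)"
  have exp_in: "exp \<zeta> \<in> ball 0 1 - {0} \<and> \<rho> \<le> cmod (exp \<zeta>)" if "\<zeta> \<in> cbox lo hi" for \<zeta>
  proof -
    have "exp (ln \<rho>) \<le> exp (Re \<zeta>)" "exp (Re \<zeta>) \<le> exp (ln r)"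
      using that by (auto simp: in_cbox_complex_iff lo_def hi_def)
    then have "\<rho> \<le> cmod (exp \<zeta>)" "cmod (exp \<zeta>) < 1"
      using \<rho> unfolding norm_exp_eq_Re by (auto simp del: exp_less_one_iff)
    then show ?thesis by simp
  qed
  have u_cont: "continuous_on (cbox lo hi) u"
    unfolding u_def p_def
    by (intro continuous_intros continuous_on_compose2[OF holomorphic_on_imp_continuous_on[OF l_holo]])
       (use exp_in in auto)
  have J: "\<bar>(cmod (u \<zeta>))\<^sup>2 - (cmod (v \<zeta>))\<^sup>2\<bar> = D * (cmod (u \<zeta>))\<^sup>2" for \<zeta>
  proof -
    have "(cmod (u \<zeta>))\<^sup>2 - (cmod (v \<zeta>))\<^sup>2 = D * (cmod (u \<zeta>))\<^sup>2"
      by (simp add: v_def D_def norm_mult algebra_simps power_mult_distrib)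
    then show ?thesis using D0 by simp
  qed
  have "integral {Re lo..Re hi} (\<lambda>s. integral {Im lo..Im hi}
          (\<lambda>t. \<bar>(cmod (u (Complex s t)))\<^sup>2 - (cmod (v (Complex s t)))\<^sup>2\<bar>)) \<le> pi * R\<^sup>2"
  proof (rule planar_area_bound[where f = f and u = u and v = v and a = lo and b = hi and R = R])
    show "(f has_derivative (\<lambda>h. u x * h + v x * cnj h)) (at x)" if "x \<in> box lo hi" for x
    proof -
      have "((\<lambda>\<zeta>. F (exp \<zeta>)) has_field_derivative (p (exp x) / (exp x)\<^sup>2) * exp x) (at x)"
        using exp_in[of x] that box_subset_cbox[of lo hi] by (intro DERIV_chain2[OF F_der] DERIV_exp) auto
      moreover have ux: "(p (exp x) / (exp x)\<^sup>2) * exp x = u x"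
        by (simp add: u_def power2_eq_square)
      ultimately have "((\<lambda>\<zeta>. F (exp \<zeta>)) has_derivative (\<lambda>h. u x * h)) (at x)"
        unfolding ux has_field_derivative_def by simp
      then have "((\<lambda>\<zeta>. F (exp \<zeta>) - c * cnj (F (exp \<zeta>))) has_derivative (\<lambda>h. u x * h - c * cnj (u x * h))) (at x)"
        by (intro derivative_intros has_derivative_cnj)
      then show ?thesis unfolding f_def T_def v_def by (simp add: mult.assoc)
    qed
    show "inj_on f (box lo hi)"
    proof (rule inj_onI)
      fix x y
      assume xy: "x \<in> box lo hi" "y \<in> box lo hi" "f x = f y"
      then have "T (F (exp x)) = T (F (exp y))" by (simp add: f_def)
      then have "F (exp x) = F (exp y)" by (rule injD[OF T_inj])
      moreover have "x \<in> cbox lo hi" "y \<in> cbox lo hi"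
        using xy(1,2) by (simp_all add: in_box_complex_iff in_cbox_complex_iff)
      ultimately have "exp x = exp y"
        using inj_onD[OF inj] exp_in[of x] exp_in[of y] by simp
      moreover have "\<bar>Im x - Im y\<bar> < 2 * pi"
        using xy(1,2) unfolding in_box_complex_iff lo_def hi_def complex.sel greaterThanLessThan_iff by linarith
      ultimately show "x = y" by (simp add: exp_complex_eqI)
    qed
    show "continuous_on (cbox lo hi) v" unfolding v_def by (intro continuous_intros u_cont)
    show "f ` box lo hi \<subseteq> cball 0 R"
    proof
      fix w assume "w \<in> f ` box lo hi"
      then obtain x where x: "x \<in> box lo hi" "w = f x" by auto
      then have "x \<in> cbox lo hi" using box_subset_cbox by blast
      from exp_in[OF this] have "F (exp x) \<in> E" using FE by auto
      then show "w \<in> cball 0 R" by (simp add: E_def x f_def)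
    qed
  qed (fact u_cont R0)+
  then have up: "integral {ln \<rho>..ln r} (\<lambda>s. integral {0..2*pi} (\<lambda>t. D * (cmod (u (Complex s t)))\<^sup>2)) \<le> pi * R\<^sup>2"
    unfolding J by (simp add: lo_def hi_def)
  have exp_sq: "exp (-2 * s) = 1 / (exp s)\<^sup>2" "exp (2 * s) = (exp s)\<^sup>2" for s :: real
    by (simp add: exp_double[symmetric] exp_minus[symmetric] flip: inverse_eq_divide) (rule exp_double)
  define g where "g s = 2 * pi * D * (exp (-2 * s) + (cmod b)\<^sup>2 * exp (2 * s))" for s
  \<comment> \<open>\<open>G\<close> is an antiderivative of the lower bound \<open>g\<close> for the integral over one circle.\<close>
  define G where "G s = 2 * pi * D * (- exp (-2 * s) / 2 + (cmod b)\<^sup>2 * exp (2 * s) / 2)" for s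
  have "(g has_integral (G (ln r) - G (ln \<rho>))) {ln \<rho>..ln r}"
    by (rule fundamental_theorem_of_calculus)
       (use \<rho> in \<open>auto simp: G_def[abs_def] g_def has_real_derivative_iff_has_vector_derivative[symmetric] intro!: derivative_eq_intros\<close>)
  moreover have "(\<lambda>s. integral {0..2*pi} (\<lambda>t. D * (cmod (u (Complex s t)))\<^sup>2)) integrable_on {ln \<rho>..ln r}"
  proof (rule integrable_continuous_real)
    have "continuous_on ({ln \<rho>..ln r} \<times> cbox 0 (2*pi)) (\<lambda>(s,t). D * (cmod (u (Complex s t)))\<^sup>2)"
      unfolding split_beta
      by (intro continuous_intros continuous_on_compose2[OF u_cont])
         (auto simp: Complex_eq in_cbox_complex_iff lo_def hi_def intro!: continuous_intros)
    then have "continuous_on {ln \<rho>..ln r} (\<lambda>s. integral (cbox 0 (2*pi)) (\<lambda>t. D * (cmod (u (Complex s t)))\<^sup>2))"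
      by (rule integral_continuous_on_param)
    then show "continuous_on {ln \<rho>..ln r} (\<lambda>s. integral {0..2*pi} (\<lambda>t. D * (cmod (u (Complex s t)))\<^sup>2))"
      by simp
  qed
  moreover have "g s \<le> integral {0..2*pi} (\<lambda>t. D * (cmod (u (Complex s t)))\<^sup>2)" if s: "s \<in> {ln \<rho>..ln r}" for s
  proof -
    define x where "x = exp s"
    have x: "0 < x" "x < 1"
    proof -
      have "s < 0" using s \<rho> ln_less_zero[of r] by (auto simp del: ln_less_zero_iff)
      then show "0 < x" "x < 1" by (auto simp: x_def)
    qed
    have "(\<lambda>t. D * (cmod (u (Complex s t)))\<^sup>2) = (\<lambda>t. D / x\<^sup>2 * (cmod (p (of_real x * cis t)))\<^sup>2)"
      by (simp add: fun_eq_iff u_def exp_eq_polar norm_divide norm_mult power_divide x_def)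
    then have "integral {0..2*pi} (\<lambda>t. D * (cmod (u (Complex s t)))\<^sup>2)
        = D / x\<^sup>2 * integral {0..2*pi} (\<lambda>t. (cmod (p (of_real x * cis t)))\<^sup>2)"
      by (simp only: integral_mult_right)
    moreover have "2 * pi * (1 + (cmod b)\<^sup>2 * x ^ 4) \<le> integral {0..2*pi} (\<lambda>t. (cmod (p (of_real x * cis t)))\<^sup>2)"
      unfolding p_def by (rule circle_square_mean_ge[OF l_holo x])
    ultimately have "D / x\<^sup>2 * (2 * pi * (1 + (cmod b)\<^sup>2 * x ^ 4)) \<le> integral {0..2*pi} (\<lambda>t. D * (cmod (u (Complex s t)))\<^sup>2)"
      using D0 by (simp only:) (intro mult_left_mono, auto)
    moreover have "D / x\<^sup>2 * (2 * pi * (1 + (cmod b)\<^sup>2 * x ^ 4)) = g s"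
    proof -
      have "D / y * (2 * pi * (1 + (cmod b)\<^sup>2 * y\<^sup>2)) = 2 * pi * D * (1 / y + (cmod b)\<^sup>2 * y)"
        if "y \<noteq> 0" for y :: real
        using that by (simp add: field_simps power2_eq_square)
      from this[of "x\<^sup>2"] show ?thesis
        using x unfolding g_def exp_sq x_def by (simp flip: power_mult)
    qed
    ultimately show ?thesis by simp
  qed
  ultimately have "G (ln r) - G (ln \<rho>) \<le> integral {ln \<rho>..ln r} (\<lambda>s. integral {0..2*pi} (\<lambda>t. D * (cmod (u (Complex s t)))\<^sup>2))"
    by (meson has_integral_le integrable_integral)
  with up have "G (ln r) - G (ln \<rho>) \<le> pi * R\<^sup>2" by simp
  moreover have "G (ln x) = pi * D * ((cmod b)\<^sup>2 * x\<^sup>2 - 1 / x\<^sup>2)" if "0 < x" for x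
    using that unfolding G_def exp_sq by (simp add: algebra_simps)
  ultimately have "pi * (D * ((1/\<rho>\<^sup>2 - 1/r\<^sup>2) + (cmod b)\<^sup>2 * (r\<^sup>2 - \<rho>\<^sup>2))) \<le> pi * R\<^sup>2"
    using \<rho> by (simp add: algebra_simps)
  then show ?thesis
    using \<rho> by (simp add: D_def c_def R_def norm_mult norm_power)
qed

text \<open>
  Both sides of the area inequality blow up like \<open>1/\<rho>\<^sup>2\<close>. After cancellation \<open>\<rho> \<rightarrow> 0\<close> leaves
  \<open>\<bar>b\<bar>\<^sup>2 r\<^sup>2 \<le> 1/r\<^sup>2\<close>, and then \<open>r \<rightarrow> 1\<close>. The constant coefficient is normalized to 0, which is only a
  translation of the image.
\<close>

theorem area_theorem:
  fixes k :: "complex \<Rightarrow> complex" and b :: complex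
  assumes k: "k holomorphic_on ball 0 1" and inj: "inj_on (\<lambda>z. 1 / z + b * z + z\<^sup>2 * k z) (ball 0 1 - {0})"
  shows "cmod b \<le> 1"
proof -
  have "bounded (k ` cball 0 (1/2))"
    by (intro compact_imp_bounded compact_continuous_image holomorphic_on_imp_continuous_on holomorphic_on_subset[OF k]) auto
  then obtain M where M: "\<And>z. cmod z \<le> 1/2 \<Longrightarrow> cmod (k z) \<le> M"
    unfolding bounded_iff by (metis image_eqI mem_cball_0)
  then have M0: "0 \<le> M" using order_trans[OF norm_ge_zero M[of 0]] by simp
  define B where "B = cmod b"
  have main: "B\<^sup>2 * r\<^sup>2 \<le> 1 / r\<^sup>2" if r: "0 < r" "r < 1" for r
  proof (rule tendsto_upperbound)
    \<comment> \<open>The difference of both sides of the area inequality, plus \<open>1/r\<^sup>2\<close>, with all negative powers of \<open>\<rho>\<close> cancelled.\<close>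
    define \<phi> where "\<phi> \<rho> = B\<^sup>2 * r\<^sup>2 - 2 * B\<^sup>2 * \<rho>\<^sup>2 + B\<^sup>2 * \<rho> ^ 4 / r\<^sup>2 - B ^ 4 * \<rho> ^ 4 * (r\<^sup>2 - \<rho>\<^sup>2)
       - 4 * M * \<rho> - 4 * M\<^sup>2 * \<rho> ^ 4" for \<rho>
    show "(\<phi> \<longlongrightarrow> B\<^sup>2 * r\<^sup>2) (at_right 0)"
      unfolding \<phi>_def using r by (auto intro!: tendsto_eq_intros)
    have \<phi>: "\<phi> \<rho> - 1/r\<^sup>2 = (1 - (B * \<rho>\<^sup>2)\<^sup>2) * ((1/\<rho>\<^sup>2 - 1/r\<^sup>2) + B\<^sup>2 * (r\<^sup>2 - \<rho>\<^sup>2)) - (1/\<rho> + 2 * M * \<rho>\<^sup>2)\<^sup>2"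
      if "\<rho> > 0" for \<rho>
      unfolding \<phi>_def using that r by (simp add: field_simps) algebra
    have "eventually (\<lambda>\<rho>::real. B * \<rho>\<^sup>2 < 1) (at_right 0)" by real_asymp
    moreover have "eventually (\<lambda>\<rho>::real. \<rho> \<in> {0<..<min r (1/2)}) (at_right 0)"
      by (rule eventually_at_right_real) (use r in auto)
    ultimately show "eventually (\<lambda>\<rho>. \<phi> \<rho> \<le> 1 / r\<^sup>2) (at_right 0)"
    proof eventually_elim
      case (elim \<rho>)
      then show ?case
        using area_inequality[OF k inj, of \<rho> r M] r M M0 \<phi>[of \<rho>] by (simp add: B_def)
    qed
  qed auto
  have "B\<^sup>2 \<le> 1"
  proof (rule tendsto_lowerbound)
    show "((\<lambda>r::real. 1 / r\<^sup>2 - B\<^sup>2 * (r\<^sup>2 - 1)) \<longlongrightarrow> 1) (at_left 1)" by real_asymp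
    have "eventually (\<lambda>r::real. r \<in> {0<..<1}) (at_left 1)"
      by (rule eventually_at_left_real) auto
    then show "eventually (\<lambda>r::real. B\<^sup>2 \<le> 1 / r\<^sup>2 - B\<^sup>2 * (r\<^sup>2 - 1)) (at_left 1)"
      by eventually_elim (use main in \<open>auto simp: algebra_simps\<close>)
  qed auto
  then show ?thesis by (simp add: B_def power2_le_imp_le abs_square_le_1)
qed

section \<open>The Schwarzian derivative and disk automorphisms\<close>

text \<open>
  Reads the Schwarzian off from explicit formulas for the first derivative and for the
  logarithmic derivative \<open>P = \<phi>''/\<phi>'\<close>. All Schwarzians below are computed in this way.
\<close>

lemma schwarzian_eqI:
  assumes S: "open S" "z \<in> S"
    and \<phi>: "\<And>w. w \<in> S \<Longrightarrow> (\<phi> has_field_derivative \<phi>1 w) (at w)"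
    and \<phi>1: "\<And>w. w \<in> S \<Longrightarrow> (\<phi>1 has_field_derivative \<phi>1 w * P w) (at w)"
    and nz: "\<And>w. w \<in> S \<Longrightarrow> \<phi>1 w \<noteq> 0"
    and P: "(P has_field_derivative P') (at z)"
  shows "schwarzian \<phi> z = P' - 1/2 * (P z)\<^sup>2"
proof -
  have 1: "deriv \<phi> w = \<phi>1 w" if "w \<in> S" for w
    by (rule DERIV_imp_deriv[OF \<phi>[OF that]])
  have "(deriv \<phi> has_field_derivative \<phi>1 w * P w) (at w)" if "w \<in> S" for w
    by (rule has_field_derivative_transform_within_open[OF \<phi>1[OF that] S(1) that]) (simp add: 1)
  then have 2: "deriv (deriv \<phi>) w = \<phi>1 w * P w" if "w \<in> S" for w
    using that by (simp add: DERIV_imp_deriv)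
  have 3: "deriv (deriv \<phi>) w / deriv \<phi> w = P w" if "w \<in> S" for w
    using nz that by (simp add: 1 2)
  have "((\<lambda>w. deriv (deriv \<phi>) w / deriv \<phi> w) has_field_derivative P') (at z)"
    by (rule has_field_derivative_transform_within_open[OF P S]) (simp add: 3)
  then show ?thesis
    unfolding schwarzian_def using 3[OF S(2)] by (simp add: DERIV_imp_deriv)
qed

lemma moebius_0_surj:
  assumes "cmod a < 1"
  shows "Moebius_function 0 a ` unit_disk = unit_disk"
proof
  show "Moebius_function 0 a ` unit_disk \<subseteq> unit_disk"
    using Moebius_function_norm_lt_1[OF assms] by auto
  show "unit_disk \<subseteq> Moebius_function 0 a ` unit_disk"
  proof
    fix z :: complex assume z: "z \<in> unit_disk"
    have "Moebius_function 0 a (Moebius_function 0 (-a) z) = z"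
      using assms z by (intro Moebius_function_compose) auto
    then show "z \<in> Moebius_function 0 a ` unit_disk"
      using z Moebius_function_norm_lt_1[of "-a" z 0] assms by (metis image_eqI mem_ball_0 norm_minus_cancel)
  qed
qed

text \<open>
  The chain rule of the Schwarzian for the automorphism \<open>T \<zeta> = (\<zeta> + a) / (1 + cnj a \<zeta>)\<close>: it sends 0 to
  \<open>a\<close>, has derivative \<open>1 - \<bar>a\<bar>\<^sup>2\<close> at 0, and contributes no Schwarzian of its own.
\<close>

lemma schwarzian_compose_moebius:
  assumes \<phi>: "\<phi> holomorphic_on unit_disk" "\<And>z. z \<in> unit_disk \<Longrightarrow> deriv \<phi> z \<noteq> 0" and a: "cmod a < 1"
  shows "schwarzian (\<phi> \<circ> Moebius_function 0 (-a)) 0 = schwarzian \<phi> a * (1 - (cmod a)\<^sup>2)\<^sup>2"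
proof -
  define T where "T \<zeta> = (\<zeta> + a) / (1 + cnj a * \<zeta>)" for \<zeta>
  have T: "Moebius_function 0 (-a) = T"
    by (simp add: fun_eq_iff T_def Moebius_function_simple)
  define t where "t = 1 - a * cnj a"
  have t: "t = complex_of_real (1 - (cmod a)\<^sup>2)"
    unfolding t_def of_real_diff complex_norm_square by simp
  define Q where "Q z = deriv (deriv \<phi>) z / deriv \<phi> z" for z
  have nz: "1 + cnj a * \<zeta> \<noteq> 0" if "\<zeta> \<in> unit_disk" for \<zeta>
  proof
    assume "1 + cnj a * \<zeta> = 0"
    then have "cmod (cnj a * \<zeta>) = 1" by (metis add_eq_0_iff norm_minus_cancel norm_one)
    moreover have "cmod (cnj a * \<zeta>) < 1" using norm_mult_less[of "cnj a" 1 \<zeta> 1] a that by simp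
    ultimately show False by simp
  qed
  have T_in: "T \<zeta> \<in> unit_disk" if "\<zeta> \<in> unit_disk" for \<zeta>
    using Moebius_function_norm_lt_1[of "-a" \<zeta> 0] a that by (simp add: T)
  have T_der: "(T has_field_derivative t / (1 + cnj a * \<zeta>)\<^sup>2) (at \<zeta>)" if "\<zeta> \<in> unit_disk" for \<zeta>
    unfolding T_def t_def using nz[OF that]
    by (auto intro!: derivative_eq_intros simp: field_simps power2_eq_square)
  have d: "deriv \<phi> holomorphic_on unit_disk" "deriv (deriv \<phi>) holomorphic_on unit_disk"
    by (auto intro!: holomorphic_intros \<phi>)
  have "Q holomorphic_on unit_disk"
    unfolding Q_def by (intro holomorphic_intros \<phi>) auto
  then have Q_der: "(Q has_field_derivative deriv Q z) (at z)" if "z \<in> unit_disk" for z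
    using that by (intro holomorphic_derivI) auto
  define P where "P \<zeta> = Q (T \<zeta>) * (t / (1 + cnj a * \<zeta>)\<^sup>2) - 2 * cnj a / (1 + cnj a * \<zeta>)" for \<zeta>
  have "schwarzian (\<phi> \<circ> T) 0 = ((deriv Q a * t) * t + Q a * (- 2 * cnj a * t) + 2 * (cnj a)\<^sup>2) - 1/2 * (P 0)\<^sup>2"
  proof (rule schwarzian_eqI[where S = unit_disk and ?\<phi>1.0 = "\<lambda>\<zeta>. deriv \<phi> (T \<zeta>) * (t / (1 + cnj a * \<zeta>)\<^sup>2)"])
    fix \<zeta> assume \<zeta>: "\<zeta> \<in> unit_disk"
    show "(\<phi> \<circ> T has_field_derivative deriv \<phi> (T \<zeta>) * (t / (1 + cnj a * \<zeta>)\<^sup>2)) (at \<zeta>)"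
      using \<zeta> T_in by (intro DERIV_chain T_der holomorphic_derivI[OF \<phi>(1)]) auto
    have "((\<lambda>\<zeta>. deriv \<phi> (T \<zeta>)) has_field_derivative deriv (deriv \<phi>) (T \<zeta>) * (t / (1 + cnj a * \<zeta>)\<^sup>2)) (at \<zeta>)"
      using \<zeta> T_in by (intro DERIV_chain2[of "deriv \<phi>"] T_der holomorphic_derivI[OF d(1)]) auto
    moreover have "((\<lambda>\<zeta>. t / (1 + cnj a * \<zeta>)\<^sup>2) has_field_derivative (t / (1 + cnj a * \<zeta>)\<^sup>2) * (- 2 * cnj a / (1 + cnj a * \<zeta>))) (at \<zeta>)"
      using nz[OF \<zeta>]
      by (auto intro!: derivative_eq_intros simp: divide_simps power2_eq_square)
    ultimately have prod: "((\<lambda>\<zeta>. deriv \<phi> (T \<zeta>) * (t / (1 + cnj a * \<zeta>)\<^sup>2)) has_field_derivative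
       deriv (deriv \<phi>) (T \<zeta>) * (t / (1 + cnj a * \<zeta>)\<^sup>2) * (t / (1 + cnj a * \<zeta>)\<^sup>2)
       + (t / (1 + cnj a * \<zeta>)\<^sup>2) * (- 2 * cnj a / (1 + cnj a * \<zeta>)) * deriv \<phi> (T \<zeta>)) (at \<zeta>)"
      by (rule DERIV_mult)
    have QT: "deriv (deriv \<phi>) (T \<zeta>) = Q (T \<zeta>) * deriv \<phi> (T \<zeta>)"
      using \<phi>(2)[OF T_in[OF \<zeta>]] by (simp add: Q_def)
    show "((\<lambda>\<zeta>. deriv \<phi> (T \<zeta>) * (t / (1 + cnj a * \<zeta>)\<^sup>2)) has_field_derivative
        deriv \<phi> (T \<zeta>) * (t / (1 + cnj a * \<zeta>)\<^sup>2) * P \<zeta>) (at \<zeta>)"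
      by (rule DERIV_cong[OF prod]) (simp add: QT P_def algebra_simps)
    have "t \<noteq> 0" using a unfolding t of_real_eq_0_iff by (simp add: abs_square_eq_1)
    then show "deriv \<phi> (T \<zeta>) * (t / (1 + cnj a * \<zeta>)\<^sup>2) \<noteq> 0"
      using \<phi>(2)[OF T_in[OF \<zeta>]] nz[OF \<zeta>] by simp
  next
    have "T 0 = a" by (simp add: T_def)
    then have "((\<lambda>\<zeta>. Q (T \<zeta>)) has_field_derivative deriv Q a * (t / (1 + cnj a * 0)\<^sup>2)) (at 0)"
      using a by (intro DERIV_chain2[of Q] T_der Q_der) (auto simp: Q_der)
    then show "(P has_field_derivative (deriv Q a * t) * t + Q a * (- 2 * cnj a * t) + 2 * (cnj a)\<^sup>2) (at 0)"
      unfolding P_def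
      by (auto intro!: derivative_eq_intros simp: \<open>T 0 = a\<close> power2_eq_square)
  qed auto
  also have "\<dots> = (deriv Q a - 1/2 * (Q a)\<^sup>2) * t\<^sup>2"
    by (simp add: P_def T_def power2_eq_square algebra_simps)
  also have "deriv Q a - 1/2 * (Q a)\<^sup>2 = schwarzian \<phi> a"
    by (simp add: Q_def[abs_def] schwarzian_def)
  finally show ?thesis by (simp add: T t o_def)
qed

text \<open>
  An automorphism of the disk changes neither univalence nor the image, so any bound at the origin
  that depends only on these gives the weighted bound at all points.
\<close>

lemma schwarzian_bound_transport:
  assumes at0: "\<And>\<psi>. \<psi> holomorphic_on unit_disk \<Longrightarrow> inj_on \<psi> unit_disk \<Longrightarrow> \<psi> ` unit_disk = \<phi> ` unit_disk
                  \<Longrightarrow> cmod (schwarzian \<psi> 0) \<le> B"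
    and holo: "\<phi> holomorphic_on unit_disk" and inj: "inj_on \<phi> unit_disk" and z: "z \<in> unit_disk"
  shows "cmod (schwarzian \<phi> z) * (1 - (cmod z)\<^sup>2)\<^sup>2 \<le> B"
proof -
  define T where "T = Moebius_function 0 (-z)"
  have z1: "cmod (-z) < 1" using z by simp
  have im: "T ` unit_disk = unit_disk" unfolding T_def by (rule moebius_0_surj[OF z1])
  have "inj_on T unit_disk"
    by (rule inj_on_inverseI[of _ "Moebius_function 0 z"])
       (use z in \<open>auto simp: T_def intro!: Moebius_function_compose\<close>)
  have reg: "deriv \<phi> w \<noteq> 0" if "w \<in> unit_disk" for w
    using holomorphic_injective_imp_regular[OF holo _ inj that] by simp
  have "cmod (schwarzian (\<phi> \<circ> T) 0) \<le> B"
  proof (rule at0)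
    show "\<phi> \<circ> T holomorphic_on unit_disk"
      by (rule holomorphic_on_compose_gen[OF _ holo])
         (use im in \<open>auto simp: T_def Moebius_function_holomorphic[OF z1]\<close>)
    show "inj_on (\<phi> \<circ> T) unit_disk"
      by (rule comp_inj_on) (use \<open>inj_on T unit_disk\<close> inj im in auto)
    show "(\<phi> \<circ> T) ` unit_disk = \<phi> ` unit_disk" by (metis im image_comp)
  qed
  also have "schwarzian (\<phi> \<circ> T) 0 = schwarzian \<phi> z * (1 - (cmod z)\<^sup>2)\<^sup>2"
    unfolding T_def by (rule schwarzian_compose_moebius[OF holo reg]) (use z in auto)
  finally have "cmod (schwarzian \<phi> z * of_real ((1 - (cmod z)\<^sup>2)\<^sup>2)) \<le> B" by simp
  then show ?thesis unfolding norm_mult norm_of_real by simp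
qed

section \<open>Univalent functions\<close>

lemma holomorphic_expand_at_0:
  assumes "f holomorphic_on unit_disk"
  obtains q where "q holomorphic_on unit_disk" "\<And>z. z \<in> unit_disk \<Longrightarrow> f z = f 0 + z * q z" "q 0 = deriv f 0"
proof -
  have "(\<lambda>z. f z - f 0) holomorphic_on unit_disk" by (intro holomorphic_intros assms)
  then obtain q where q: "q holomorphic_on unit_disk"
    "\<And>z. cmod z < 1 \<Longrightarrow> f z - f 0 = z * q z" "deriv (\<lambda>z. f z - f 0) 0 = q 0"
    by (rule Schwarz3) (simp, rule that)
  have "(f has_field_derivative deriv f 0) (at 0)"
    by (rule holomorphic_derivI[OF assms]) auto
  then have "((\<lambda>z. f z - f 0) has_field_derivative deriv f 0 - 0) (at 0)"
    by (intro DERIV_diff DERIV_const)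
  then have "deriv (\<lambda>z. f z - f 0) 0 = deriv f 0" by (simp add: DERIV_imp_deriv)
  then have "q 0 = deriv f 0" using q(3) by simp
  moreover have "f z = f 0 + z * q z" if "z \<in> unit_disk" for z
    using q(2)[of z] that by (simp add: diff_eq_eq add.commute)
  ultimately show ?thesis by (intro that[of q] q(1))
qed

text \<open>
  Write \<open>\<phi> z = \<phi> 0 + z q z\<close> and \<open>e = q 0 / q\<close>. Then \<open>e z / z = \<phi>' 0 / (\<phi> z - \<phi> 0)\<close> is univalent with a
  simple pole at 0, and the area theorem bounds the coefficient of \<open>z\<^sup>2\<close> in \<open>e\<close>. The Schwarzian at 0 is \<open>- 6\<close>
  times that coefficient.
\<close>

lemma schwarzian_at_0_univalent:
  assumes holo: "\<phi> holomorphic_on unit_disk" and inj: "inj_on \<phi> unit_disk"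
  shows "cmod (schwarzian \<phi> 0) \<le> 6"
proof -
  have reg: "deriv \<phi> z \<noteq> 0" if "z \<in> unit_disk" for z
    using holomorphic_injective_imp_regular[OF holo _ inj that] by simp
  obtain q where q: "q holomorphic_on unit_disk" "\<And>z. z \<in> unit_disk \<Longrightarrow> \<phi> z = \<phi> 0 + z * q z" "q 0 = deriv \<phi> 0"
    by (rule holomorphic_expand_at_0[OF holo]) blast
  have q_nz: "q z \<noteq> 0" if "z \<in> unit_disk" for z
  proof (cases "z = 0")
    case True then show ?thesis using q(3) reg[of 0] by simp
  next
    case False
    then have "\<phi> z \<noteq> \<phi> 0" using inj that by (auto simp: inj_on_def)
    then show ?thesis using q(2)[OF that] by auto
  qed
  define e where "e z = q 0 / q z" for z
  have e_holo: "e holomorphic_on unit_disk" unfolding e_def by (intro holomorphic_intros q q_nz)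
  have e0: "e 0 = 1" using q_nz[of 0] by (simp add: e_def)
  have e_nz: "e z \<noteq> 0" if "z \<in> unit_disk" for z using q_nz that q_nz[of 0] by (simp add: e_def)
  obtain e1 where e1: "e1 holomorphic_on unit_disk" "\<And>z. z \<in> unit_disk \<Longrightarrow> e z = 1 + z * e1 z"
    using holomorphic_expand_at_0[OF e_holo] unfolding e0 by metis
  obtain e2 where e2: "e2 holomorphic_on unit_disk" "\<And>z. z \<in> unit_disk \<Longrightarrow> e1 z = e1 0 + z * e2 z"
    using holomorphic_expand_at_0[OF e1(1)] by metis
  obtain k where k: "k holomorphic_on unit_disk" "\<And>z. z \<in> unit_disk \<Longrightarrow> e2 z = e2 0 + z * k z"
    using holomorphic_expand_at_0[OF e2(1)] by metis
  define b0 where "b0 = e1 0"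
  define b where "b = e2 0"
  have e: "e z = 1 + b0 * z + b * z\<^sup>2 + z ^ 3 * k z" if "z \<in> unit_disk" for z
    using e1(2)[OF that] e2(2)[OF that] k(2)[OF that]
    by (simp add: b0_def b_def power2_eq_square power3_eq_cube algebra_simps)
  have "cmod b \<le> 1"
  proof (rule area_theorem[OF k(1)])
    have F: "1 / z + b * z + z\<^sup>2 * k z = q 0 / (\<phi> z - \<phi> 0) - b0" if "z \<in> ball 0 1 - {0}" for z
    proof -
      have "q 0 / (\<phi> z - \<phi> 0) = e z / z" using q(2)[of z] that by (simp add: e_def)
      then show ?thesis using e[of z] that by (simp add: field_simps power2_eq_square power3_eq_cube)
    qed
    have "inj_on (\<lambda>z. q 0 / (\<phi> z - \<phi> 0) - b0) (ball 0 1 - {0})"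
    proof (rule inj_onI)
      fix x y assume xy: "x \<in> ball 0 1 - {0::complex}" "y \<in> ball 0 1 - {0::complex}" "q 0 / (\<phi> x - \<phi> 0) - b0 = q 0 / (\<phi> y - \<phi> 0) - b0"
      have "\<phi> x \<noteq> \<phi> 0" "\<phi> y \<noteq> \<phi> 0" using inj_onD[OF inj, of x 0] inj_onD[OF inj, of y 0] xy by auto
      then have "\<phi> x = \<phi> y" using xy(3) q_nz[of 0] by (simp add: field_simps)
      then show "x = y" using inj xy by (auto simp: inj_on_def)
    qed
    then show "inj_on (\<lambda>z. 1 / z + b * z + z\<^sup>2 * k z) (ball 0 1 - {0})"
      by (subst inj_on_cong[OF F]) 
  qed
  moreover have "schwarzian \<phi> 0 = - 6 * b"
  proof -
    define E1 where "E1 z = b0 + 2 * b * z + 3 * z\<^sup>2 * k z + z ^ 3 * deriv k z" for z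
    define E2 where "E2 z = 2 * b + 6 * z * k z + 6 * z\<^sup>2 * deriv k z + z ^ 3 * deriv (deriv k) z" for z
    have k1: "(k has_field_derivative deriv k z) (at z)" if "z \<in> unit_disk" for z
      using that by (intro holomorphic_derivI[OF k(1)]) auto
    have k'_holo: "deriv k holomorphic_on unit_disk" "deriv (deriv k) holomorphic_on unit_disk"
      by (auto intro!: holomorphic_intros k)
    have k2: "(deriv k has_field_derivative deriv (deriv k) z) (at z)" if "z \<in> unit_disk" for z
      using that by (intro holomorphic_derivI[OF k'_holo(1)]) auto
    have ed: "(e has_field_derivative E1 z) (at z)" if "z \<in> unit_disk" for z
      by (rule has_field_derivative_transform_within_open[of "\<lambda>z. 1 + b0 * z + b * z\<^sup>2 + z ^ 3 * k z" _ _ unit_disk])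
         (use that e in \<open>auto intro!: derivative_eq_intros k1 simp: E1_def algebra_simps power2_eq_square power3_eq_cube\<close>)
    have E1d: "(E1 has_field_derivative E2 z) (at z)" if "z \<in> unit_disk" for z
      unfolding E1_def using that
      by (auto intro!: derivative_eq_intros k1 k2 simp: E2_def algebra_simps power2_eq_square power3_eq_cube)
    have E2_holo: "E2 holomorphic_on unit_disk"
      unfolding E2_def by (intro holomorphic_intros k k'_holo)
    then have E2d: "(E2 has_field_derivative deriv E2 0) (at 0)"
      by (intro holomorphic_derivI[of _ unit_disk]) auto
    \<comment> \<open>\<open>N\<close> is the numerator of the derivative of \<open>z / e z\<close>; the second order term of \<open>e\<close> survives in \<open>N' = - z e''\<close>.\<close>
    define N where "N z = e z - z * E1 z" for z
    have Nd: "(N has_field_derivative - z * E2 z) (at z)" if "z \<in> unit_disk" for z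
      unfolding N_def using that by (auto intro!: derivative_eq_intros ed E1d)
    define P where "P z = - z * E2 z / N z - 2 * E1 z / e z" for z
    define \<phi>1 where "\<phi>1 z = q 0 * N z / (e z)\<^sup>2" for z
    have \<phi>d: "(\<phi> has_field_derivative \<phi>1 z) (at z)" if "z \<in> unit_disk" for z
    proof (rule has_field_derivative_transform_within_open[of "\<lambda>z. \<phi> 0 + z * (q 0 / e z)" _ _ unit_disk])
      show "((\<lambda>z. \<phi> 0 + z * (q 0 / e z)) has_field_derivative \<phi>1 z) (at z)"
      proof (rule DERIV_cong)
        show "((\<lambda>z. \<phi> 0 + z * (q 0 / e z)) has_field_derivative
            0 + (1 * (q 0 / e z) + ((0 * e z - q 0 * E1 z) / (e z * e z)) * z)) (at z)"
          by (intro DERIV_add DERIV_const DERIV_mult DERIV_ident DERIV_divide ed e_nz that)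
        show "0 + (1 * (q 0 / e z) + ((0 * e z - q 0 * E1 z) / (e z * e z)) * z) = \<phi>1 z"
          using e_nz[OF that] by (simp add: \<phi>1_def N_def field_simps power2_eq_square)
      qed
      show "\<phi> 0 + x * (q 0 / e x) = \<phi> x" if "x \<in> unit_disk" for x
        using q(2)[OF that] q_nz[OF that] q_nz[of 0] by (simp add: e_def)
    qed (use that in auto)
    have \<phi>1_nz: "\<phi>1 z \<noteq> 0" if "z \<in> unit_disk" for z
      using DERIV_imp_deriv[OF \<phi>d[OF that]] reg[OF that] by simp
    then have N_nz: "N z \<noteq> 0" if "z \<in> unit_disk" for z using that by (auto simp: \<phi>1_def)
    have "schwarzian \<phi> 0 = (- 2 * b - (4 * b - 2 * b0\<^sup>2)) - 1/2 * (P 0)\<^sup>2"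
    proof (rule schwarzian_eqI[of unit_disk])
      show "(\<phi>1 has_field_derivative \<phi>1 w * P w) (at w)" if "w \<in> unit_disk" for w
      proof (rule DERIV_cong)
        show "(\<phi>1 has_field_derivative
            ((0 * N w + (- w * E2 w) * q 0) * (e w)\<^sup>2 - q 0 * N w * (of_nat 2 * (E1 w * e w ^ (2 - Suc 0)))) / ((e w)\<^sup>2 * (e w)\<^sup>2)) (at w)"
          unfolding \<phi>1_def[abs_def]
          by (intro DERIV_const DERIV_mult DERIV_divide DERIV_power ed Nd that) (use e_nz[OF that] in simp)
        show "((0 * N w + (- w * E2 w) * q 0) * (e w)\<^sup>2 - q 0 * N w * (of_nat 2 * (E1 w * e w ^ (2 - Suc 0)))) / ((e w)\<^sup>2 * (e w)\<^sup>2)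
            = \<phi>1 w * P w"
          using e_nz[OF that] N_nz[OF that] by (simp add: \<phi>1_def P_def field_simps power2_eq_square)
      qed
      have z: "(0::complex) \<in> unit_disk" by simp
      have "N 0 = 1" "E1 0 = b0" "E2 0 = 2 * b" by (simp_all add: N_def E1_def E2_def e0)
      then show "(P has_field_derivative - 2 * b - (4 * b - 2 * b0\<^sup>2)) (at 0)"
        unfolding P_def[abs_def] using e0
        by (auto intro!: derivative_eq_intros ed[OF z] Nd[OF z] E1d[OF z] E2d simp: power2_eq_square algebra_simps)
    qed (use \<phi>d \<phi>1_nz in auto)
    also have "P 0 = - 2 * b0" by (simp add: P_def E1_def e0)
    finally show ?thesis by (simp add: power2_eq_square)
  qed
  ultimately show ?thesis by (simp add: norm_mult)
qed

theorem Nehari_Kraus: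
  assumes "\<phi> holomorphic_on unit_disk" "inj_on \<phi> unit_disk" "z \<in> unit_disk"
  shows "cmod (schwarzian \<phi> z) * (1 - (cmod z)\<^sup>2)\<^sup>2 \<le> 6"
  by (rule schwarzian_bound_transport[OF _ assms]) (rule schwarzian_at_0_univalent)

section \<open>Convex functions\<close>

lemma second_derivative_nonpos_at_max:
  fixes r :: "real \<Rightarrow> real"
  assumes d: "\<And>t. (r has_real_derivative r' t) (at t)"
    and dd: "(r' has_real_derivative c) (at 0)" and r'0: "r' 0 = 0"
    and max: "\<And>t. r t \<le> r 0"
  shows "c \<le> 0"
proof (rule ccontr)
  assume "\<not> c \<le> 0"
  then obtain \<delta> where \<delta>: "\<delta> > 0" "\<And>t. t > 0 \<Longrightarrow> t < \<delta> \<Longrightarrow> 0 < r' t"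
    using DERIV_pos_inc_right[OF dd] r'0 by force
  have "r 0 < r (\<delta>/2)"
  proof (rule DERIV_pos_imp_increasing_open[where f = r])
    show "continuous_on {0..\<delta>/2} r"
      using d by (meson DERIV_isCont continuous_at_imp_continuous_on)
    show "\<exists>y. (r has_real_derivative y) (at x) \<and> 0 < y" if "0 < x" "x < \<delta>/2" for x
      using d[of x] \<delta>(2)[of x] that \<delta>(1) by (intro exI[of _ "r' x"]) auto
  qed (use \<delta> in auto)
  then show False using max[of "\<delta>/2"] by simp
qed

text \<open>
  By convexity the midpoint of \<open>\<phi> (\<zeta> exp (i t))\<close> and \<open>\<phi> (\<zeta> exp (- i t))\<close> lies in the image, so its
  preimage under \<open>\<phi>\<close>, as a function of \<open>\<zeta>\<close>, is a self-map of the disk fixing 0. By the Schwarz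
  lemma it does not increase the modulus, while at \<open>t = 0\<close> it is the identity. Hence, for fixed
  \<open>\<zeta> = z\<close>, the real function \<open>r t = Re (cnj z \<gamma> (\<dots>))\<close> has a maximum at \<open>t = 0\<close>, and its second
  derivative there is \<open>- \<bar>z\<bar>\<^sup>2 Re (1 + z \<phi>''/\<phi>')\<close>.
\<close>

lemma convex_univalent_positive_real_part:
  assumes holo: "\<phi> holomorphic_on unit_disk" and inj: "inj_on \<phi> unit_disk"
    and conv: "convex (\<phi> ` unit_disk)" and z: "z \<in> unit_disk"
  shows "0 \<le> Re (1 + z * (deriv (deriv \<phi>) z / deriv \<phi> z))"
proof -
  define \<Omega> where "\<Omega> = \<phi> ` unit_disk"
  have \<Omega>_open: "open \<Omega>" unfolding \<Omega>_def by (rule open_mapping_thm3[OF holo _ inj]) simp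
  obtain \<gamma> where \<gamma>: "\<gamma> holomorphic_on \<Omega>" "\<And>w. w \<in> unit_disk \<Longrightarrow> deriv \<phi> w * deriv \<gamma> (\<phi> w) = 1"
     "\<And>w. w \<in> unit_disk \<Longrightarrow> \<gamma> (\<phi> w) = w"
    unfolding \<Omega>_def by (rule holomorphic_has_inverse[OF holo _ inj]) auto
  have \<gamma>_in: "\<gamma> w \<in> unit_disk" if "w \<in> \<Omega>" for w using that \<gamma>(3) unfolding \<Omega>_def by auto
  define m where "m s \<zeta> = (\<phi> (\<zeta> * exp (\<i> * s)) + \<phi> (\<zeta> * exp (- (\<i> * s)))) / 2" for s \<zeta>
  have rot: "\<zeta> * exp (\<i> * of_real t) \<in> unit_disk" "\<zeta> * exp (- (\<i> * of_real t)) \<in> unit_disk"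
    if "\<zeta> \<in> unit_disk" for \<zeta> t
    using that by (auto simp: norm_mult norm_exp_eq_Re)
  have m_in: "m (of_real t) \<zeta> \<in> \<Omega>" if "\<zeta> \<in> unit_disk" for \<zeta> t
  proof -
    have "(1/2) *\<^sub>R \<phi> (\<zeta> * exp (\<i> * of_real t)) + (1/2) *\<^sub>R \<phi> (\<zeta> * exp (- (\<i> * of_real t))) \<in> \<Omega>"
      using conv rot[OF that, of t] unfolding \<Omega>_def by (intro convexD) auto
    then show ?thesis by (simp add: m_def scaleR_conv_of_real field_simps)
  qed
  have schwarz: "cmod (\<gamma> (m (of_real t) z)) \<le> cmod z" for t
  proof (rule Schwarz_Lemma(1)[of "\<lambda>\<zeta>. \<gamma> (m (of_real t) \<zeta>)"])
    have "(\<lambda>\<zeta>. m (of_real t) \<zeta>) holomorphic_on unit_disk"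
      unfolding m_def
      by (intro holomorphic_intros holomorphic_on_compose_gen[OF _ holo, unfolded o_def]) (use rot in auto)
    then show "(\<lambda>\<zeta>. \<gamma> (m (of_real t) \<zeta>)) holomorphic_on ball 0 1"
      by (rule holomorphic_on_compose_gen[OF _ \<gamma>(1), unfolded o_def]) (use m_in in auto)
    show "\<gamma> (m (of_real t) 0) = 0" using \<gamma>(3)[of 0] by (simp add: m_def)
    show "cmod (\<gamma> (m (of_real t) \<zeta>)) < 1" if "cmod \<zeta> < 1" for \<zeta>
      using \<gamma>_in[OF m_in[of \<zeta> t]] that by simp
  qed (use z in auto)
  \<comment> \<open>\<open>M\<close> is the midpoint as a function of the angle, \<open>M1\<close> its derivative; only even terms survive at angle 0.\<close>
  define p where "p s = z * exp (\<i> * s)" for s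
  define n where "n s = z * exp (- (\<i> * s))" for s
  have pd: "(p has_field_derivative \<i> * p s) (at s)" and nd: "(n has_field_derivative - \<i> * n s) (at s)" for s
    unfolding p_def n_def by (auto intro!: derivative_eq_intros)
  have pn: "p (of_real t) \<in> unit_disk" "n (of_real t) \<in> unit_disk" for t
    using rot[OF z] unfolding p_def n_def by auto
  have \<phi>d: "(\<phi> has_field_derivative deriv \<phi> w) (at w)" if "w \<in> unit_disk" for w
    by (rule holomorphic_derivI[OF holo _ that]) simp
  have \<phi>dd: "(deriv \<phi> has_field_derivative deriv (deriv \<phi>) w) (at w)" if "w \<in> unit_disk" for w
    by (rule holomorphic_derivI[OF _ _ that]) (auto intro!: holomorphic_intros holo)
  have \<gamma>d: "(\<gamma> has_field_derivative deriv \<gamma> w) (at w)" if "w \<in> \<Omega>" for w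
    by (rule holomorphic_derivI[OF \<gamma>(1) \<Omega>_open that])
  have \<gamma>dd: "(deriv \<gamma> has_field_derivative deriv (deriv \<gamma>) w) (at w)" if "w \<in> \<Omega>" for w
    by (rule holomorphic_derivI[OF _ \<Omega>_open that]) (intro holomorphic_deriv \<gamma> \<Omega>_open)
  define M where "M s = m s z" for s
  define M1 where "M1 s = (deriv \<phi> (p s) * (\<i> * p s) + deriv \<phi> (n s) * (- \<i> * n s)) / 2" for s
  have Md: "(M has_field_derivative M1 (of_real t)) (at (of_real t))" for t
  proof -
    have "((\<lambda>s. (\<phi> (p s) + \<phi> (n s)) / 2) has_field_derivative M1 (of_real t)) (at (of_real t))"
      unfolding M1_def
      by (intro DERIV_cdivide DERIV_add DERIV_chain2[OF \<phi>d] pd nd pn)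
    then show ?thesis unfolding M_def m_def p_def n_def .
  qed
  have p0: "p 0 = z" "n 0 = z" by (simp_all add: p_def n_def)
  have "((\<lambda>s. (deriv \<phi> (p s) * (\<i> * p s) + deriv \<phi> (n s) * (- \<i> * n s)) / 2) has_field_derivative
        ((deriv (deriv \<phi>) (p 0) * (\<i> * p 0)) * (\<i> * p 0) + (\<i> * (\<i> * p 0)) * deriv \<phi> (p 0)
        + ((deriv (deriv \<phi>) (n 0) * (- \<i> * n 0)) * (- \<i> * n 0) + (- \<i> * (- \<i> * n 0)) * deriv \<phi> (n 0))) / 2) (at 0)"
    by (intro DERIV_cdivide DERIV_add DERIV_mult DERIV_chain2[OF \<phi>dd] pd nd DERIV_cmult)
       (use z in \<open>simp_all add: p0\<close>)
  then have M1d: "(M1 has_field_derivative - (z\<^sup>2 * deriv (deriv \<phi>) z + z * deriv \<phi> z)) (at 0)"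
    unfolding M1_def[abs_def] by (rule DERIV_cong) (simp add: p0 power2_eq_square field_simps)
  have M10: "M1 0 = 0" by (simp add: M1_def p0)
  have M0: "M 0 = \<phi> z" by (simp add: M_def m_def)
  have M_in: "M (of_real t) \<in> \<Omega>" for t unfolding M_def by (rule m_in[OF z])
  define r where "r t = Re (cnj z * \<gamma> (M (of_real t)))" for t
  define r' where "r' t = Re (cnj z * (deriv \<gamma> (M (of_real t)) * M1 (of_real t)))" for t
  have rd: "(r has_real_derivative r' t) (at t)" for t
    unfolding r_def r'_def
    by (intro has_field_derivative_Re has_vector_derivative_real_field DERIV_cmult DERIV_chain2[OF \<gamma>d] Md M_in)
  define c where "c = - (z\<^sup>2 * deriv (deriv \<phi>) z + z * deriv \<phi> z)"
  have "((\<lambda>s. deriv \<gamma> (M s) * M1 s) has_field_derivative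
      (deriv (deriv \<gamma>) (M 0) * M1 0) * M1 0 + c * deriv \<gamma> (M 0)) (at 0)"
    unfolding c_def using M_in[of 0] Md[of 0]
    by (intro DERIV_mult M1d DERIV_chain2[OF \<gamma>dd]) auto
  then have "((\<lambda>s. cnj z * (deriv \<gamma> (M s) * M1 s)) has_field_derivative cnj z * (c * deriv \<gamma> (\<phi> z))) (at (of_real 0))"
    by (intro DERIV_cmult) (simp add: M10 M0)
  then have r'd: "(r' has_real_derivative Re (cnj z * (c * deriv \<gamma> (\<phi> z)))) (at 0)"
    unfolding r'_def by (intro has_field_derivative_Re has_vector_derivative_real_field)
  have "Re (cnj z * (c * deriv \<gamma> (\<phi> z))) \<le> 0"
  proof (rule second_derivative_nonpos_at_max[OF rd r'd])
    show "r' 0 = 0" by (simp add: r'_def M10)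
    fix t
    have "r t \<le> cmod (cnj z * \<gamma> (M (of_real t)))" unfolding r_def by (rule complex_Re_le_cmod)
    also have "\<dots> \<le> cmod z * cmod z"
      unfolding norm_mult complex_mod_cnj M_def by (intro mult_left_mono schwarz) auto
    also have "\<dots> = r 0"
      unfolding r_def of_real_0 M0 \<gamma>(3)[OF z] mult.commute[of "cnj z" z] complex_norm_square[symmetric]
      by (simp add: power2_eq_square)
    finally show "r t \<le> r 0" .
  qed
  moreover have eq: "cnj z * (c * deriv \<gamma> (\<phi> z)) = - of_real ((cmod z)\<^sup>2) * (1 + z * (deriv (deriv \<phi>) z / deriv \<phi> z))"
  proof -
    have nz: "deriv \<phi> z \<noteq> 0" using \<gamma>(2)[OF z] by auto
    then have "deriv \<gamma> (\<phi> z) = 1 / deriv \<phi> z" using \<gamma>(2)[OF z] by (simp add: field_simps)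
    then show ?thesis
      unfolding complex_norm_square c_def using nz by (simp add: field_simps power2_eq_square)
  qed
  moreover have Re_scale: "Re (- of_real a * x) = - (a * Re x)" for a x by simp
  ultimately have "Re (- of_real ((cmod z)\<^sup>2) * (1 + z * (deriv (deriv \<phi>) z / deriv \<phi> z))) \<le> 0"
    by metis
  then have "0 \<le> (cmod z)\<^sup>2 * Re (1 + z * (deriv (deriv \<phi>) z / deriv \<phi> z))"
    unfolding Re_scale by simp
  then show ?thesis by (cases "z = 0") (auto simp: zero_le_mult_iff)
qed

text \<open>
  With \<open>P = \<phi>''/\<phi>'\<close>, the condition \<open>Re (1 + z P) \<ge> 0\<close> says that \<open>\<bar>z P\<bar> \<le> \<bar>2 + z P\<bar>\<close>, so
  \<open>\<bar>z\<bar> \<bar>w\<bar> \<le> 1\<close> for \<open>w = P / (2 + z P)\<close>. Cauchy's inequality on circles of radius tending to 1 then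
  bounds \<open>w' 0\<close>, which is half of the Schwarzian.
\<close>

lemma schwarzian_at_0_convex:
  assumes holo: "\<phi> holomorphic_on unit_disk" and inj: "inj_on \<phi> unit_disk"
    and conv: "convex (\<phi> ` unit_disk)"
  shows "cmod (schwarzian \<phi> 0) \<le> 2"
proof -
  have reg: "deriv \<phi> z \<noteq> 0" if "z \<in> unit_disk" for z
    using holomorphic_injective_imp_regular[OF holo _ inj that] by simp
  define P where "P z = deriv (deriv \<phi>) z / deriv \<phi> z" for z
  have P_holo: "P holomorphic_on unit_disk"
    unfolding P_def by (intro holomorphic_intros holo reg) auto
  have pos: "0 \<le> Re (1 + z * P z)" if "z \<in> unit_disk" for z
    unfolding P_def by (rule convex_univalent_positive_real_part[OF holo inj conv that])
  then have nz: "2 + z * P z \<noteq> 0" if "z \<in> unit_disk" for z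
    using pos[OF that] by (auto simp: complex_eq_iff)
  define w where "w z = P z / (2 + z * P z)" for z
  have w_holo: "w holomorphic_on unit_disk"
    unfolding w_def by (intro holomorphic_intros P_holo nz)
  have w_bound: "cmod z * cmod (w z) \<le> 1" if "z \<in> unit_disk" for z
  proof -
    define x where "x = z * P z"
    have "0 \<le> 4 + 4 * Re x" using pos[OF that] by (simp add: x_def)
    then have "(cmod x)\<^sup>2 \<le> (cmod (2 + x))\<^sup>2"
      unfolding cmod_power2 by (simp add: power2_eq_square algebra_simps)
    then have "cmod x \<le> cmod (2 + x)" by (rule power2_le_imp_le) simp
    moreover have "0 < cmod (2 + x)" using nz[OF that] by (simp add: x_def)
    ultimately have "cmod x / cmod (2 + x) \<le> 1" by simp
    then show ?thesis by (simp add: w_def x_def norm_mult norm_divide)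
  qed
  have "cmod (deriv w 0) * r\<^sup>2 \<le> 1" if r: "0 < r" "r < 1" for r
  proof -
    have "cmod ((deriv ^^ 1) w 0) \<le> fact 1 * (1 / r) / r ^ 1"
    proof (rule Cauchy_inequality)
      show "w holomorphic_on ball 0 r" by (rule holomorphic_on_subset[OF w_holo]) (use r in auto)
      show "continuous_on (cball 0 r) w"
        by (rule holomorphic_on_imp_continuous_on, rule holomorphic_on_subset[OF w_holo]) (use r in auto)
      show "cmod (w x) \<le> 1 / r" if "cmod (0 - x) = r" for x
        using w_bound[of x] that r by (simp add: field_simps)
    qed (use r in auto)
    then show ?thesis using r by (simp add: field_simps power2_eq_square)
  qed
  then have lim: "\<forall>\<^sub>F r in at_left (1::real). cmod (deriv w 0) * r\<^sup>2 \<le> 1"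
    using eventually_at_left_real[of 0 "1::real"] by (auto elim: eventually_mono)
  have "cmod (deriv w 0) \<le> 1"
    by (rule tendsto_upperbound[OF _ lim]) (auto intro!: tendsto_eq_intros)
  moreover have "schwarzian \<phi> 0 = 2 * deriv w 0"
  proof -
    have Pd: "(P has_field_derivative deriv P 0) (at 0)"
      by (rule holomorphic_derivI[OF P_holo]) auto
    have "(w has_field_derivative
       (deriv P 0 * (2 + 0 * P 0) - P 0 * (0 + (1 * P 0 + deriv P 0 * 0))) / ((2 + 0 * P 0) * (2 + 0 * P 0))) (at 0)"
      unfolding w_def[abs_def] by (intro DERIV_divide DERIV_add DERIV_const DERIV_mult DERIV_ident Pd) simp
    then have W: "deriv w 0 = (deriv P 0 * 2 - P 0 * P 0) / 4"
      by (simp add: DERIV_imp_deriv)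
    have S: "schwarzian \<phi> 0 = deriv P 0 - 1/2 * (P 0)\<^sup>2"
      by (simp add: schwarzian_def P_def[abs_def])
    show ?thesis unfolding W S by (simp add: power2_eq_square field_simps)
  qed
  ultimately show ?thesis by (simp add: norm_mult)
qed

theorem Nehari_convex:
  assumes "\<phi> holomorphic_on unit_disk" "inj_on \<phi> unit_disk" "convex (\<phi> ` unit_disk)" "z \<in> unit_disk"
  shows "cmod (schwarzian \<phi> z) * (1 - (cmod z)\<^sup>2)\<^sup>2 \<le> 2"
  using assms(3) by (intro schwarzian_bound_transport[OF _ assms(1,2,4)] schwarzian_at_0_convex) simp_all

section \<open>From the analytic pencil to the harmonic mapping\<close>

lemma one_plus_mult_nonzero:
  fixes c w :: complex
  assumes "cmod c \<le> 1" "cmod w < 1"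
  shows "1 + c * w \<noteq> 0"
proof
  assume "1 + c * w = 0"
  then have "cmod (c * w) = 1" by (metis add_eq_0_iff norm_minus_cancel norm_one)
  moreover have "cmod (c * w) \<le> 1 * cmod w"
    unfolding norm_mult using assms by (intro mult_right_mono) auto
  ultimately show False using assms by simp
qed

text \<open>
  This follows from \<open>(h + c g)' = h' (1 + c \<omega>)\<close>. The point of the formula is its form as a function
  of \<open>c\<close>: at fixed \<open>z\<close> it is holomorphic on the closed unit disk, and it becomes the harmonic
  Schwarzian at \<open>c = - cnj (\<omega> z)\<close>.
\<close>

lemma schwarzian_pencil:
  assumes h: "h holomorphic_on unit_disk" and g: "g holomorphic_on unit_disk"
    and sp: "sense_preserving h g" and c: "cmod c \<le> 1" and z: "z \<in> unit_disk"
  defines "\<omega> \<equiv> dilatation h g"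
  shows "schwarzian (\<lambda>w. h w + c * g w) z =
           schwarzian h z + c / (1 + c * \<omega> z) * (deriv (deriv \<omega>) z - deriv (deriv h) z / deriv h z * deriv \<omega> z)
           - 3/2 * (c * deriv \<omega> z / (1 + c * \<omega> z))\<^sup>2"
proof -
  have reg: "deriv h w \<noteq> 0" and small: "cmod (\<omega> w) < 1" if "w \<in> unit_disk" for w
    using sp that by (auto simp: sense_preserving_def \<omega>_def)
  define Q where "Q w = deriv (deriv h) w / deriv h w" for w
  have h_holo: "deriv h holomorphic_on unit_disk" "deriv (deriv h) holomorphic_on unit_disk"
    by (auto intro!: holomorphic_intros h)
  have \<omega>_holo: "\<omega> holomorphic_on unit_disk"
    unfolding \<omega>_def dilatation_def by (intro holomorphic_intros h g reg) auto
  have Q_holo: "Q holomorphic_on unit_disk"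
    unfolding Q_def by (intro holomorphic_intros h_holo reg)
  have \<omega>'_holo: "deriv \<omega> holomorphic_on unit_disk" by (intro holomorphic_intros \<omega>_holo) auto
  have nz: "1 + c * \<omega> w \<noteq> 0" if "w \<in> unit_disk" for w
    by (rule one_plus_mult_nonzero[OF c small[OF that]])
  have dg: "deriv g w = deriv h w * \<omega> w" if "w \<in> unit_disk" for w
    using reg[OF that] by (simp add: \<omega>_def dilatation_def)
  define P where "P w = Q w + c * deriv \<omega> w / (1 + c * \<omega> w)" for w
  have D: "(f has_field_derivative deriv f w) (at w)" if "f holomorphic_on unit_disk" "w \<in> unit_disk" for f w
    by (rule holomorphic_derivI[OF that(1) _ that(2)]) simp
  define P' where "P' = deriv Q z + ((0 * deriv \<omega> z + deriv (deriv \<omega>) z * c) * (1 + c * \<omega> z) - (c * deriv \<omega> z) * (0 + (0 * \<omega> z + deriv \<omega> z * c)))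
          / ((1 + c * \<omega> z) * (1 + c * \<omega> z))"
  have "schwarzian (\<lambda>w. h w + c * g w) z = P' - 1/2 * (P z)\<^sup>2"
  proof (rule schwarzian_eqI[where S = unit_disk and ?\<phi>1.0 = "\<lambda>w. deriv h w * (1 + c * \<omega> w)"])
    fix w assume w: "w \<in> unit_disk"
    have "((\<lambda>w. h w + c * g w) has_field_derivative deriv h w + (0 * g w + deriv g w * c)) (at w)"
      by (intro DERIV_add DERIV_mult DERIV_const D h g w)
    then show "((\<lambda>w. h w + c * g w) has_field_derivative deriv h w * (1 + c * \<omega> w)) (at w)"
      by (rule DERIV_cong) (simp add: dg[OF w] algebra_simps)
    have "((\<lambda>w. deriv h w * (1 + c * \<omega> w)) has_field_derivative
        deriv (deriv h) w * (1 + c * \<omega> w) + (0 + (0 * \<omega> w + deriv \<omega> w * c)) * deriv h w) (at w)"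
      by (intro DERIV_add DERIV_mult DERIV_const D h_holo \<omega>_holo w)
    then show "((\<lambda>w. deriv h w * (1 + c * \<omega> w)) has_field_derivative deriv h w * (1 + c * \<omega> w) * P w) (at w)"
    proof (rule DERIV_cong)
      have "h2 * v + (0 + (0 * \<omega> w + x * c)) * h1 = h1 * v * (h2 / h1 + c * x / v)"
        if "h1 \<noteq> 0" "v \<noteq> 0" for h1 h2 v x :: complex
        using that by (simp add: field_simps)
      from this[OF reg[OF w] nz[OF w]]
      show "deriv (deriv h) w * (1 + c * \<omega> w) + (0 + (0 * \<omega> w + deriv \<omega> w * c)) * deriv h w
            = deriv h w * (1 + c * \<omega> w) * P w"
        unfolding P_def Q_def .
    qed
    show "deriv h w * (1 + c * \<omega> w) \<noteq> 0" using reg[OF w] nz[OF w] by simp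
  next
    show "(P has_field_derivative P') (at z)"
      unfolding P_def[abs_def] P'_def
      by (intro DERIV_add DERIV_divide DERIV_mult DERIV_const D Q_holo \<omega>_holo \<omega>'_holo z nz)
  qed (use z in auto)
  moreover define A Y where "A = c / (1 + c * \<omega> z) * deriv (deriv \<omega>) z" and "Y = c * deriv \<omega> z / (1 + c * \<omega> z)"
  have "P' = deriv Q z + (A - Y\<^sup>2)"
  proof -
    have "((0 * w1 + w2 * c) * v - (c * w1) * (0 + (0 * w0 + w1 * c))) / (v * v) = c / v * w2 - (c * w1 / v)\<^sup>2"
      if "v \<noteq> 0" for w0 w1 w2 v :: complex
      using that by (simp add: diff_divide_distrib power2_eq_square mult_ac)
    from this[OF nz[OF z]] show ?thesis unfolding P'_def A_def Y_def by simp
  qed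
  moreover have "P z = Q z + Y" by (simp add: P_def Y_def)
  moreover have "schwarzian h z = deriv Q z - 1/2 * (Q z)\<^sup>2"
    by (simp add: schwarzian_def Q_def[abs_def])
  moreover have "c / (1 + c * \<omega> z) * (deriv (deriv \<omega>) z - Q z * deriv \<omega> z) = A - Q z * Y"
    by (simp add: A_def Y_def right_diff_distrib)
  moreover have "dQ + (A - Y\<^sup>2) - 1/2 * (q + Y)\<^sup>2 = dQ - 1/2 * q\<^sup>2 + (A - q * Y) - 3/2 * Y\<^sup>2" for dQ q
    by (simp add: power2_eq_square field_simps)
  ultimately show ?thesis
    unfolding Q_def[symmetric] Y_def[symmetric] by simp
qed

lemma harmonic_schwarzian_bound:
  assumes h: "h holomorphic_on unit_disk" and g: "g holomorphic_on unit_disk"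
    and sp: "sense_preserving h g" and z: "z \<in> unit_disk"
    and B: "\<And>c. cmod c = 1 \<Longrightarrow> cmod (schwarzian (\<lambda>w. h w + c * g w) z) \<le> B"
  shows "cmod (harmonic_schwarzian h g z) \<le> B"
proof -
  define \<omega> where "\<omega> = dilatation h g"
  have small: "cmod (\<omega> z) < 1" using sp z by (auto simp: sense_preserving_def \<omega>_def)
  define \<Psi> where "\<Psi> c = schwarzian h z + c / (1 + c * \<omega> z) * (deriv (deriv \<omega>) z - deriv (deriv h) z / deriv h z * deriv \<omega> z)
           - 3/2 * (c * deriv \<omega> z / (1 + c * \<omega> z))\<^sup>2" for c
  have nz: "1 + c * \<omega> z \<noteq> 0" if "c \<in> cball 0 1" for c
    by (rule one_plus_mult_nonzero[OF _ small]) (use that in simp)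
  have holo: "\<Psi> holomorphic_on cball 0 1"
    unfolding \<Psi>_def by (intro holomorphic_intros nz)
  have "cmod (\<Psi> (- cnj (\<omega> z))) \<le> B"
  proof (rule maximum_modulus_frontier[of \<Psi> "cball 0 1"])
    show "\<Psi> holomorphic_on interior (cball 0 1)"
      by (rule holomorphic_on_subset[OF holo]) (simp add: interior_subset)
    show "continuous_on (closure (cball 0 1)) \<Psi>"
      using holo by (simp add: holomorphic_on_imp_continuous_on)
    show "cmod (\<Psi> c) \<le> B" if "c \<in> frontier (cball 0 1)" for c
    proof -
      have c: "cmod c = 1" using that by (simp add: frontier_cball)
      show ?thesis using B[OF c] schwarzian_pencil[OF h g sp _ z, of c] c unfolding \<Psi>_def \<omega>_def by simp
    qed
  qed (use small in auto)
  moreover have "harmonic_schwarzian h g z = \<Psi> (- cnj (\<omega> z))"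
  proof -
    have "1 + (- cnj (\<omega> z)) * \<omega> z = 1 - of_real ((cmod (\<omega> z))\<^sup>2)"
      unfolding complex_norm_square by simp
    then show ?thesis
      unfolding harmonic_schwarzian_def \<Psi>_def Let_def \<omega>_def[symmetric]
      by (simp add: algebra_simps diff_divide_distrib)
  qed
  ultimately show ?thesis by simp
qed

text \<open>
  Equality of the two distances would give a unimodular \<open>\<mu>\<close> for which \<open>h + \<mu> cnj g\<close> takes the same
  value at \<open>z\<close> and \<open>w\<close>. So their difference keeps its sign on the disk punctured at \<open>w\<close>, which is
  connected, and near \<open>w\<close> the sign is that of \<open>\<bar>h' w\<bar> - \<bar>g' w\<bar>\<close>.
\<close>

lemma stable_univalent_strict:
  assumes h: "h holomorphic_on unit_disk" and g: "g holomorphic_on unit_disk"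
    and sp: "sense_preserving h g"
    and inj: "\<And>\<mu>. cmod \<mu> = 1 \<Longrightarrow> inj_on (\<lambda>z. h z + \<mu> * cnj (g z)) unit_disk"
    and z: "z \<in> unit_disk" "w \<in> unit_disk" "z \<noteq> w"
  shows "cmod (g z - g w) < cmod (h z - h w)"
proof -
  define A where "A = unit_disk - {w}"
  have conn: "connected A" unfolding A_def by (rule connected_open_delete) auto
  have ne: "cmod (g x - g w) \<noteq> cmod (h x - h w)" if x: "x \<in> A" for x
  proof
    assume eq: "cmod (g x - g w) = cmod (h x - h w)"
    \<comment> \<open>If both differences vanish, any unimodular value would do.\<close>
    define \<mu> where "\<mu> = (if g x = g w then 1 else - (h x - h w) / cnj (g x - g w))"
    have "cmod (- (h x - h w) / cnj (g x - g w)) = cmod (h x - h w) / cmod (g x - g w)"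
      unfolding norm_divide norm_minus_cancel complex_mod_cnj ..
    moreover have "g x \<noteq> g w \<Longrightarrow> cmod (h x - h w) / cmod (g x - g w) = 1"
      unfolding eq[symmetric] by simp
    ultimately have \<mu>: "cmod \<mu> = 1" unfolding \<mu>_def by (cases "g x = g w") (simp_all only: if_True if_False norm_one simp_thms)
    have "\<mu> * cnj (g x - g w) = - (h x - h w)"
    proof (cases "g x = g w")
      case True
      then show ?thesis using eq by simp
    next
      case False
      then have "cnj (g x - g w) \<noteq> 0" by simp
      then show ?thesis
        unfolding \<mu>_def if_not_P[OF False] times_divide_eq_left by (rule nonzero_mult_div_cancel_right)
    qed
    then have "h x + \<mu> * cnj (g x) = h w + \<mu> * cnj (g w)"
      by (simp add: right_diff_distrib diff_eq_eq)
    then have "x = w" by (rule inj_onD[OF inj[OF \<mu>]]) (use x z in \<open>auto simp: A_def\<close>)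
    then show False using x by (simp add: A_def)
  qed
  define \<delta> where "\<delta> x = cmod (h x - h w) - cmod (g x - g w)" for x
  have cont: "continuous_on A \<delta>"
    unfolding \<delta>_def A_def
    by (intro continuous_intros holomorphic_on_imp_continuous_on holomorphic_on_subset[OF h] holomorphic_on_subset[OF g]) auto
  have ex: "\<exists>x\<in>A. 0 < \<delta> x"
  proof -
    have "deriv h w \<noteq> 0" "cmod (deriv g w) / cmod (deriv h w) < 1"
      using sp z(2) unfolding sense_preserving_def dilatation_def norm_divide by blast+
    then have "cmod (deriv g w) < cmod (deriv h w)" by (simp add: divide_less_eq)
    moreover have "((\<lambda>x. cmod ((h x - h w) / (x - w)) - cmod ((g x - g w) / (x - w))) \<longlongrightarrow> cmod (deriv h w) - cmod (deriv g w)) (at w)"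
      using holomorphic_derivI[OF h _ z(2)] holomorphic_derivI[OF g _ z(2)]
      by (intro tendsto_intros) (auto simp: has_field_derivative_iff)
    ultimately have "\<forall>\<^sub>F x in at w. 0 < cmod ((h x - h w) / (x - w)) - cmod ((g x - g w) / (x - w))"
      by (intro order_tendstoD(1)) auto
    moreover have "\<forall>\<^sub>F x in at w. x \<in> A"
      unfolding A_def using z(2) by (intro eventually_at_in_open) auto
    ultimately have "\<forall>\<^sub>F x in at w. x \<in> A \<and> 0 < \<delta> x"
    proof eventually_elim
      case (elim x)
      then have "0 < cmod (x - w)" by (auto simp: A_def)
      then show ?case using elim by (simp add: norm_divide \<delta>_def divide_simps)
    qed
    then show ?thesis using eventually_happens[of _ "at w"] by auto
  qed
  have "0 < \<delta> z"
  proof (rule ccontr)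
    assume neg: "\<not> 0 < \<delta> z"
    have "connected (\<delta> ` A)" by (rule connected_continuous_image[OF cont conn])
    moreover obtain x where "x \<in> A" "0 < \<delta> x" using ex by auto
    moreover have "z \<in> A" using z by (simp add: A_def)
    ultimately have "0 \<in> \<delta> ` A"
      using neg connectedD_interval[of "\<delta> ` A" "\<delta> z" "\<delta> x" 0] by auto
    then obtain y where "y \<in> A" "\<delta> y = 0" by auto
    then show False using ne[of y] by (simp add: \<delta>_def)
  qed
  then show ?thesis by (simp add: \<delta>_def)
qed

lemma stable_univalent_analytic:
  assumes "h holomorphic_on unit_disk" "g holomorphic_on unit_disk" "sense_preserving h g"
    and "\<And>\<mu>. cmod \<mu> = 1 \<Longrightarrow> inj_on (\<lambda>z. h z + \<mu> * cnj (g z)) unit_disk"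
    and c: "cmod c \<le> 1"
  shows "inj_on (\<lambda>z. h z + c * g z) unit_disk"
proof (rule inj_onI, rule ccontr)
  fix z w assume zw: "z \<in> unit_disk" "w \<in> unit_disk" "h z + c * g z = h w + c * g w" "z \<noteq> w"
  have "h z - h w = - (c * (g z - g w))" using zw(3) by (simp add: algebra_simps add_eq_0_iff)
  then have "cmod (h z - h w) = cmod c * cmod (g z - g w)" by (metis norm_minus_cancel norm_mult)
  also have "\<dots> \<le> 1 * cmod (g z - g w)" using c by (intro mult_right_mono) auto
  finally show False using stable_univalent_strict[OF assms(1-4) zw(1,2,4)] by simp
qed

text \<open>
  The shear construction. Let \<open>e\<close> be the direction of the chord from \<open>\<phi> z1\<close> to \<open>\<phi> z2\<close>, where
  \<open>\<phi> = h + c g\<close>. For \<open>\<mu> = - e\<^sup>2 cnj c\<close> the map \<open>\<phi>\<close> differs from \<open>f = h + \<mu> cnj g\<close> only by real multiples of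
  \<open>e\<close>. Along the preimage of the segment from \<open>f z1\<close> to \<open>f z2\<close>, which exists because the image of
  \<open>f\<close> is convex, \<open>\<phi>\<close> thus moves on the line spanned by the chord, and by the intermediate value theorem it
  reaches every point of the chord.
\<close>

lemma stable_convex_analytic:
  assumes h: "h holomorphic_on unit_disk" and g: "g holomorphic_on unit_disk"
    and inj: "\<And>\<mu>. cmod \<mu> = 1 \<Longrightarrow> inj_on (\<lambda>z. h z + \<mu> * cnj (g z)) unit_disk"
    and conv: "\<And>\<mu>. cmod \<mu> = 1 \<Longrightarrow> convex ((\<lambda>z. h z + \<mu> * cnj (g z)) ` unit_disk)"
    and c: "cmod c = 1"
  shows "convex ((\<lambda>z. h z + c * g z) ` unit_disk)"
proof -
  define \<phi> where "\<phi> z = h z + c * g z" for z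
  have "closed_segment (\<phi> z1) (\<phi> z2) \<subseteq> \<phi> ` unit_disk" if z: "z1 \<in> unit_disk" "z2 \<in> unit_disk" for z1 z2
  proof (cases "\<phi> z1 = \<phi> z2")
    case True
    then show ?thesis using z by auto
  next
    case False
    define L where "L = cmod (\<phi> z2 - \<phi> z1)"
    define e where "e = (\<phi> z2 - \<phi> z1) / L"
    have L: "L > 0" using False by (simp add: L_def)
    have e1: "cmod e = 1" using L by (simp add: e_def norm_divide L_def)
    have ee: "e * cnj e = 1" using complex_norm_square[of e] e1 by simp
    have diff: "\<phi> z2 = \<phi> z1 + of_real L * e" using L by (simp add: e_def)
    define \<mu> where "\<mu> = - (e\<^sup>2 * cnj c)"
    have \<mu>: "cmod \<mu> = 1" using e1 c by (simp add: \<mu>_def norm_mult norm_power)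
    define f where "f z = h z + \<mu> * cnj (g z)" for z
    define s where "s z = 2 * Re (cnj e * c * g z)" for z
    have \<phi>f: "\<phi> z = f z + of_real (s z) * e" for z
    proof -
      have "of_real (s z) * e = (cnj e * c * g z + cnj (cnj e * c * g z)) * e"
        unfolding complex_add_cnj s_def by simp
      also have "\<dots> = (e * cnj e) * (c * g z) + e\<^sup>2 * cnj c * cnj (g z)"
        by (simp add: algebra_simps power2_eq_square)
      finally show ?thesis by (simp add: ee \<phi>_def f_def \<mu>_def)
    qed
    have f_cont: "continuous_on unit_disk f"
      unfolding f_def by (intro continuous_intros holomorphic_on_imp_continuous_on h g)
    have f_inj: "inj_on f unit_disk" unfolding f_def by (rule inj[OF \<mu>])
    define k where "k = the_inv_into unit_disk f"
    have kf: "k (f z) = z" if "z \<in> unit_disk" for z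
      unfolding k_def by (rule the_inv_into_f_f[OF f_inj that])
    have k_cont: "continuous_on (f ` unit_disk) k"
      by (rule continuous_on_inverse_open[OF _ f_cont]) (use kf in auto)
    define \<gamma> where "\<gamma> t = (1 - t) *\<^sub>R f z1 + t *\<^sub>R f z2" for t
    have \<gamma>_in: "\<gamma> t \<in> f ` unit_disk" if "t \<in> {0..1}" for t
    proof -
      have "convex (f ` unit_disk)" unfolding f_def by (rule conv[OF \<mu>])
      then show ?thesis unfolding \<gamma>_def using that z by (intro convexD) auto
    qed
    define R where "R t = Re (cnj e * (\<phi> (k (\<gamma> t)) - \<phi> z1))" for t
    have on_line: "\<phi> (k (\<gamma> t)) = \<phi> z1 + of_real (R t) * e" and k_in: "k (\<gamma> t) \<in> unit_disk" if t: "t \<in> {0..1}" for t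
    proof -
      from \<gamma>_in[OF t] obtain x where x: "x \<in> unit_disk" "\<gamma> t = f x" by auto
      then show "k (\<gamma> t) \<in> unit_disk" by (simp add: kf)
      have "f x = f z1 + of_real t * (f z2 - f z1)"
        using x(2) by (simp add: \<gamma>_def scaleR_conv_of_real algebra_simps)
      moreover have "f z2 - f z1 = of_real (L - s z2 + s z1) * e"
        using diff unfolding \<phi>f by (simp add: algebra_simps)
      ultimately have "f x = f z1 + of_real (t * (L - s z2 + s z1)) * e" by simp
      then have "\<phi> x - \<phi> z1 = of_real (t * (L - s z2 + s z1) + s x - s z1) * e"
        unfolding \<phi>f by (simp add: algebra_simps)
      then obtain \<rho> :: real where \<rho>: "\<phi> x - \<phi> z1 = of_real \<rho> * e" by blast
      have "R t = Re (of_real \<rho> * (e * cnj e))"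
        unfolding R_def x(2) kf[OF x(1)] \<rho> by (simp add: mult_ac)
      then have "R t = \<rho>" by (simp add: ee)
      then show "\<phi> (k (\<gamma> t)) = \<phi> z1 + of_real (R t) * e"
        using \<rho> by (simp add: x(2) kf[OF x(1)] algebra_simps)
    qed
    have R_cont: "continuous_on {0..1} R"
    proof -
      have "continuous_on {0..1} (\<lambda>t. k (\<gamma> t))"
        by (rule continuous_on_compose2[OF k_cont]) (use \<gamma>_in in \<open>auto simp: \<gamma>_def intro!: continuous_intros\<close>)
      moreover have "continuous_on unit_disk \<phi>"
        unfolding \<phi>_def by (intro continuous_intros holomorphic_on_imp_continuous_on h g)
      ultimately have "continuous_on {0..1} (\<lambda>t. \<phi> (k (\<gamma> t)))"
        using continuous_on_compose2[of unit_disk \<phi> "{0..1}" "\<lambda>t. k (\<gamma> t)"] k_in by blast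
      then show ?thesis unfolding R_def by (intro continuous_intros)
    qed
    have "\<gamma> 0 = f z1" "\<gamma> 1 = f z2" by (simp_all add: \<gamma>_def)
    then have ends: "k (\<gamma> 0) = z1" "k (\<gamma> 1) = z2" using kf z by simp_all
    have R0: "R 0 = 0" by (simp add: R_def ends)
    have "R 1 = Re (of_real L * (e * cnj e))"
      unfolding R_def ends diff by (simp add: mult_ac)
    then have R1: "R 1 = L" by (simp add: ee)
    show ?thesis
    proof
      fix p assume "p \<in> closed_segment (\<phi> z1) (\<phi> z2)"
      then obtain u where u: "0 \<le> u" "u \<le> 1" "p = (1 - u) *\<^sub>R \<phi> z1 + u *\<^sub>R \<phi> z2"
        by (auto simp: closed_segment_def)
      have p: "p = \<phi> z1 + of_real (u * L) * e"
        unfolding u(3) diff by (simp add: scaleR_conv_of_real algebra_simps)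
      have "R 0 \<le> u * L" using u L by (simp add: R0)
      moreover have "u * L \<le> R 1" using mult_right_mono[of u 1 L] u L by (simp add: R1)
      ultimately obtain t where t: "t \<in> {0..1}" "R t = u * L"
        using IVT'[of R 0 "u * L" 1, OF _ _ _ R_cont] by auto
      then show "p \<in> \<phi> ` unit_disk"
        using on_line[OF t(1)] k_in[OF t(1)] p by (metis image_eqI)
    qed
  qed
  then have "convex (\<phi> ` unit_disk)" unfolding convex_contains_segment by auto
  then show ?thesis unfolding \<phi>_def .
qed

section \<open>Extremal functions\<close>

lemma harmonic_schwarzian_analytic: "harmonic_schwarzian h (\<lambda>_. 0) = schwarzian h"
  by (simp add: fun_eq_iff harmonic_schwarzian_def dilatation_def Let_def)

lemma schwarzian_norm_ge_at_0: "ereal (cmod (harmonic_schwarzian h g 0)) \<le> schwarzian_norm h g"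
  unfolding schwarzian_norm_def by (rule SUP_upper2[of 0]) auto

lemma class_SH_analytic:
  assumes "h holomorphic_on unit_disk" "inj_on h unit_disk" "h 0 = 0" "deriv h 0 = 1"
  shows "class_SH h h (\<lambda>_. 0)"
  using assms holomorphic_injective_imp_regular[OF assms(1) _ assms(2)]
  by (auto simp: class_SH_def canonical_decomposition_def sense_preserving_def dilatation_def)

lemma one_diff_nonzero: "1 - z \<noteq> 0" "1 + z \<noteq> 0" if "z \<in> unit_disk" for z :: complex
proof -
  show "1 - z \<noteq> 0" using that by auto
  show "1 + z \<noteq> 0"
  proof
    assume "1 + z = 0"
    then have "z = -1" by (simp add: add_eq_0_iff)
    then show False using that by simp
  qed
qed

definition koebe :: "complex \<Rightarrow> complex" where "koebe z = z / (1 - z)\<^sup>2"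

lemma koebe_deriv:
  assumes "z \<in> unit_disk"
  shows "(koebe has_field_derivative (1 + z) / (1 - z) ^ 3) (at z)"
  unfolding koebe_def[abs_def]
proof (rule DERIV_cong)
  show "((\<lambda>z. z / (1 - z)\<^sup>2) has_field_derivative
     (1 * (1 - z)\<^sup>2 - z * (of_nat 2 * ((0 - 1) * (1 - z) ^ (2 - Suc 0)))) / ((1 - z)\<^sup>2 * (1 - z)\<^sup>2)) (at z)"
    by (intro DERIV_divide DERIV_ident DERIV_power DERIV_diff DERIV_const) (use one_diff_nonzero[OF assms] in simp)
  have "(1 * v\<^sup>2 - u * (of_nat 2 * ((0 - 1) * v ^ (2 - Suc 0)))) / (v\<^sup>2 * v\<^sup>2) = (1 + u) / v ^ 3"
    if "u = 1 - v" "v \<noteq> 0" for u v :: complex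
    using that(2) unfolding that(1) by (simp add: field_simps power2_eq_square power3_eq_cube)
  from this[OF _ one_diff_nonzero(1)[OF assms], of z]
  show "(1 * (1 - z)\<^sup>2 - z * (of_nat 2 * ((0 - 1) * (1 - z) ^ (2 - Suc 0)))) / ((1 - z)\<^sup>2 * (1 - z)\<^sup>2)
        = (1 + z) / (1 - z) ^ 3"
    by simp
qed

lemma koebe_inj: "inj_on koebe unit_disk"
proof (rule inj_onI)
  fix z w assume zw: "z \<in> unit_disk" "w \<in> unit_disk" "koebe z = koebe w"
  then have "z * (1 - w)\<^sup>2 = w * (1 - z)\<^sup>2"
    using one_diff_nonzero(1)[OF zw(1)] one_diff_nonzero(1)[OF zw(2)] by (simp add: koebe_def frac_eq_eq)
  then have "(z - w) * (1 - z * w) = 0" by (simp add: algebra_simps power2_eq_square)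
  moreover have "1 - z * w \<noteq> 0"
    using norm_mult_less[of z 1 w 1] zw by (auto simp: dist_norm)
  ultimately show "z = w" by simp
qed

lemma koebe_schwarzian: "schwarzian koebe 0 = - 6"
proof -
  have "schwarzian koebe 0 = 2 - 1/2 * (1 / (1 + 0) + 3 / (1 - 0))\<^sup>2"
  proof (rule schwarzian_eqI[where S = unit_disk and ?\<phi>1.0 = "\<lambda>z. (1 + z) / (1 - z) ^ 3" and P = "\<lambda>z. 1 / (1 + z) + 3 / (1 - z)"])
    show "(koebe has_field_derivative (1 + w) / (1 - w) ^ 3) (at w)" if "w \<in> unit_disk" for w
      by (rule koebe_deriv[OF that])
    show "((\<lambda>z. (1 + z) / (1 - z) ^ 3) has_field_derivative (1 + w) / (1 - w) ^ 3 * (1 / (1 + w) + 3 / (1 - w))) (at w)"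
      if w: "w \<in> unit_disk" for w
    proof (rule DERIV_cong)
      show "((\<lambda>z. (1 + z) / (1 - z) ^ 3) has_field_derivative
         ((0 + 1) * (1 - w) ^ 3 - (1 + w) * (of_nat 3 * ((0 - 1) * (1 - w) ^ (3 - Suc 0)))) / ((1 - w) ^ 3 * (1 - w) ^ 3)) (at w)"
        by (intro DERIV_divide DERIV_ident DERIV_power DERIV_diff DERIV_add DERIV_const) (use one_diff_nonzero[OF w] in simp)
      have "((0 + 1) * v ^ 3 - u * (of_nat 3 * ((0 - 1) * v ^ (3 - Suc 0)))) / (v ^ 3 * v ^ 3) = u / v ^ 3 * (1 / u + 3 / v)"
        if "u \<noteq> 0" "v \<noteq> 0" for u v :: complex
        using that by (simp add: field_simps power2_eq_square power3_eq_cube)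
      from this[OF one_diff_nonzero(2,1)[OF w]]
      show "((0 + 1) * (1 - w) ^ 3 - (1 + w) * (of_nat 3 * ((0 - 1) * (1 - w) ^ (3 - Suc 0)))) / ((1 - w) ^ 3 * (1 - w) ^ 3)
          = (1 + w) / (1 - w) ^ 3 * (1 / (1 + w) + 3 / (1 - w))" .
    qed
    show "(1 + w) / (1 - w) ^ 3 \<noteq> 0" if "w \<in> unit_disk" for w
      using one_diff_nonzero[OF that] by simp
    show "((\<lambda>z. 1 / (1 + z) + 3 / (1 - z)) has_field_derivative 2) (at (0::complex))"
      by (auto intro!: derivative_eq_intros)
  qed auto
  then show ?thesis by simp
qed

lemma koebe_SHU: "SHU koebe koebe (\<lambda>_. 0)"
proof -
  have "koebe holomorphic_on unit_disk"
    unfolding koebe_def[abs_def] by (intro holomorphic_intros) (use one_diff_nonzero in auto)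
  moreover have "koebe 0 = 0" by (simp add: koebe_def)
  moreover have "deriv koebe 0 = 1" using DERIV_imp_deriv[OF koebe_deriv[of 0]] by simp
  ultimately show ?thesis
    unfolding SHU_def using koebe_inj class_SH_analytic[of koebe] by simp
qed

text \<open>
  The inverse hyperbolic tangent, written so that the image is visible: the fraction maps the disk onto
  the right half-plane.
\<close>

definition strip_map :: "complex \<Rightarrow> complex" where "strip_map z = Ln ((1 + z) / (1 - z)) / 2"

lemma cayley_Re_pos:
  assumes "z \<in> unit_disk"
  shows "0 < Re ((1 + z) / (1 - z))"
proof -
  have "Re ((1 + z) * cnj (1 - z)) = 1 - (cmod z)\<^sup>2"
    unfolding cmod_power2 by (simp add: power2_eq_square algebra_simps)
  moreover have "(cmod z)\<^sup>2 < 1" using assms by (simp add: abs_square_less_1)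
  moreover have "0 < (cmod (1 - z))\<^sup>2" using one_diff_nonzero(1)[OF assms] by simp
  ultimately show ?thesis unfolding complex_div_cnj[of "1 + z"] by (simp add: Re_divide_of_real)
qed

lemma strip_map_deriv:
  assumes "z \<in> unit_disk"
  shows "(strip_map has_field_derivative 1 / ((1 - z) * (1 + z))) (at z)"
  unfolding strip_map_def[abs_def]
proof (rule DERIV_cong)
  have "(1 + z) / (1 - z) \<notin> \<real>\<^sub>\<le>\<^sub>0"
    using cayley_Re_pos[OF assms] by (auto simp: complex_nonpos_Reals_iff)
  then have "(Ln has_field_derivative inverse ((1 + z) / (1 - z))) (at ((1 + z) / (1 - z)))"
    by (rule has_field_derivative_Ln)
  moreover have "((\<lambda>z. (1 + z) / (1 - z)) has_field_derivative
       ((0 + 1) * (1 - z) - (1 + z) * (0 - 1)) / ((1 - z) * (1 - z))) (at z)"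
    by (intro DERIV_divide DERIV_ident DERIV_diff DERIV_add DERIV_const one_diff_nonzero assms)
  ultimately show "((\<lambda>z. Ln ((1 + z) / (1 - z)) / 2) has_field_derivative
     inverse ((1 + z) / (1 - z)) * (((0 + 1) * (1 - z) - (1 + z) * (0 - 1)) / ((1 - z) * (1 - z))) / 2) (at z)"
    by (intro DERIV_cdivide DERIV_chain2[where f = Ln])
  have "inverse (u / v) * ((v + u) / (v * v)) / 2 = (v + u) / (2 * (v * u))" if "u \<noteq> 0" "v \<noteq> 0" for u v :: complex
    using that by (simp add: field_simps)
  from this[OF one_diff_nonzero(2,1)[OF assms]]
  show "inverse ((1 + z) / (1 - z)) * (((0 + 1) * (1 - z) - (1 + z) * (0 - 1)) / ((1 - z) * (1 - z))) / 2
     = 1 / ((1 - z) * (1 + z))" by simp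
qed

lemma strip_map_exp:
  assumes "z \<in> unit_disk"
  shows "exp (2 * strip_map z) = (1 + z) / (1 - z)"
  using one_diff_nonzero[OF assms] by (simp add: strip_map_def)

lemma strip_map_inj: "inj_on strip_map unit_disk"
proof (rule inj_onI)
  fix z w assume zw: "z \<in> unit_disk" "w \<in> unit_disk" "strip_map z = strip_map w"
  then have "(1 + z) / (1 - z) = (1 + w) / (1 - w)" by (metis strip_map_exp)
  then have "(1 + z) * (1 - w) = (1 + w) * (1 - z)"
    using one_diff_nonzero(1)[OF zw(1)] one_diff_nonzero(1)[OF zw(2)] by (simp add: frac_eq_eq)
  then show "z = w" by (simp add: algebra_simps)
qed

lemma strip_map_image: "strip_map ` unit_disk = {w. \<bar>Im w\<bar> < pi / 4}"
proof (intro equalityI subsetI)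
  fix w assume "w \<in> strip_map ` unit_disk"
  then obtain z where z: "z \<in> unit_disk" "w = strip_map z" by auto
  have "\<bar>Im (Ln ((1 + z) / (1 - z)))\<bar> < pi / 2"
    using cayley_Re_pos[OF z(1)] one_diff_nonzero[OF z(1)] by (subst Re_Ln_pos_lt) auto
  then show "w \<in> {w. \<bar>Im w\<bar> < pi / 4}" by (simp add: z(2) strip_map_def)
next
  fix w assume "w \<in> {w. \<bar>Im w\<bar> < pi / 4}"
  then have w: "\<bar>Im w\<bar> < pi / 4" by simp
  define E where "E = exp (2 * w)"
  have LnE: "Ln E = 2 * w" unfolding E_def by (rule Ln_exp) (use w in auto)
  have "cos (Im (2 * w)) > 0" by (rule cos_gt_zero_pi) (use w in auto)
  then have "Re E > 0" unfolding E_def Re_exp by simp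
  then have E1: "E + 1 \<noteq> 0" by (auto simp: complex_eq_iff)
  define z where "z = (E - 1) / (E + 1)"
  have "(cmod (E - 1))\<^sup>2 < (cmod (E + 1))\<^sup>2"
    using \<open>Re E > 0\<close> unfolding cmod_power2 by (simp add: power2_eq_square algebra_simps)
  then have "cmod (E - 1) < cmod (E + 1)" by (rule power_less_imp_less_base) simp
  then have z: "z \<in> unit_disk" using E1 by (simp add: z_def norm_divide)
  have "1 + z = 2 * E / (E + 1)" "1 - z = 2 / (E + 1)" using E1 by (simp_all add: z_def field_simps)
  then have "(1 + z) / (1 - z) = E" using E1 by simp
  then have "strip_map z = w" by (simp add: strip_map_def LnE)
  then show "w \<in> strip_map ` unit_disk" using z by auto
qed

lemma strip_map_convex: "convex (strip_map ` unit_disk)"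
proof -
  have "{w. \<bar>Im w\<bar> < pi / 4} = Im -` {- (pi/4)<..<pi/4}" by auto
  moreover have "convex (Im -` {- (pi/4)<..<pi/4})"
    by (rule convex_linear_vimage) (auto intro: bounded_linear.linear bounded_linear_Im)
  ultimately show ?thesis unfolding strip_map_image by simp
qed

lemma strip_map_schwarzian: "schwarzian strip_map 0 = 2"
proof -
  have "schwarzian strip_map 0 = 2 - 1/2 * (1 / (1 - 0) - 1 / (1 + 0))\<^sup>2"
  proof (rule schwarzian_eqI[where S = unit_disk and ?\<phi>1.0 = "\<lambda>z. 1 / ((1 - z) * (1 + z))" and P = "\<lambda>z. 1 / (1 - z) - 1 / (1 + z)"])
    show "((\<lambda>z. 1 / ((1 - z) * (1 + z))) has_field_derivative 1 / ((1 - w) * (1 + w)) * (1 / (1 - w) - 1 / (1 + w))) (at w)"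
      if w: "w \<in> unit_disk" for w
    proof (rule DERIV_cong)
      show "((\<lambda>z. 1 / ((1 - z) * (1 + z))) has_field_derivative
         (0 * ((1 - w) * (1 + w)) - 1 * ((0 - 1) * (1 + w) + (0 + 1) * (1 - w))) / (((1 - w) * (1 + w)) * ((1 - w) * (1 + w)))) (at w)"
        by (intro DERIV_divide DERIV_mult DERIV_ident DERIV_diff DERIV_add DERIV_const) (use one_diff_nonzero[OF w] in simp)
      have "(v - u) / ((u * v) * (u * v)) = 1 / (u * v) * (1 / u - 1 / v)" if "u \<noteq> 0" "v \<noteq> 0" for u v :: complex
        using that by (simp add: field_simps)
      from this[OF one_diff_nonzero[OF w]]
      show "(0 * ((1 - w) * (1 + w)) - 1 * ((0 - 1) * (1 + w) + (0 + 1) * (1 - w))) / (((1 - w) * (1 + w)) * ((1 - w) * (1 + w)))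
         = 1 / ((1 - w) * (1 + w)) * (1 / (1 - w) - 1 / (1 + w))" by simp
    qed
    show "1 / ((1 - w) * (1 + w)) \<noteq> 0" if "w \<in> unit_disk" for w
      using one_diff_nonzero[OF that] by simp
    show "((\<lambda>z. 1 / (1 - z) - 1 / (1 + z)) has_field_derivative 2) (at (0::complex))"
      by (auto intro!: derivative_eq_intros)
  qed (auto intro: strip_map_deriv)
  then show ?thesis by simp
qed

lemma strip_map_SHC: "SHC strip_map strip_map (\<lambda>_. 0)"
proof -
  have "strip_map holomorphic_on unit_disk"
    using strip_map_deriv by (meson field_differentiable_at_within field_differentiable_def holomorphic_on_def)
  moreover have "strip_map 0 = 0" by (simp add: strip_map_def)
  moreover have "deriv strip_map 0 = 1" using DERIV_imp_deriv[OF strip_map_deriv[of 0]] by simp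
  ultimately show ?thesis
    unfolding SHC_def using strip_map_inj strip_map_convex class_SH_analytic[of strip_map] by simp
qed

section \<open>Sharp bounds for the Schwarzian norm\<close>

lemma schwarzian_norm_le:
  assumes h: "h holomorphic_on unit_disk" and g: "g holomorphic_on unit_disk"
    and sp: "sense_preserving h g"
    and B: "\<And>c z. cmod c = 1 \<Longrightarrow> z \<in> unit_disk \<Longrightarrow>
              cmod (schwarzian (\<lambda>w. h w + c * g w) z) * (1 - (cmod z)\<^sup>2)\<^sup>2 \<le> B"
  shows "schwarzian_norm h g \<le> ereal B"
  unfolding schwarzian_norm_def
proof (rule SUP_least)
  fix z :: complex assume z: "z \<in> unit_disk"
  then have pos: "0 < (1 - (cmod z)\<^sup>2)\<^sup>2" by (simp add: abs_square_eq_1)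
  have "cmod (harmonic_schwarzian h g z) \<le> B / (1 - (cmod z)\<^sup>2)\<^sup>2"
    by (rule harmonic_schwarzian_bound[OF h g sp z]) (use B z pos in \<open>simp add: pos_le_divide_eq\<close>)
  then show "ereal (cmod (harmonic_schwarzian h g z) * (1 - (cmod z)\<^sup>2)\<^sup>2) \<le> ereal B"
    using pos by (simp add: pos_le_divide_eq)
qed

theorem theorem2:
  shows "(\<forall>f h g. canonical_decomposition f h g \<and> locally_univalent f \<longrightarrow>
            (SHU f h g \<longrightarrow> schwarzian_norm h g \<le> 6) \<and>
            (SHC f h g \<longrightarrow> schwarzian_norm h g \<le> 2))
       \<and> (\<forall>C::real. C < 6 \<longrightarrow> (\<exists>f h g. SHU f h g \<and> schwarzian_norm h g > ereal C))
       \<and> (\<forall>C::real. C < 2 \<longrightarrow> (\<exists>f h g. SHC f h g \<and> schwarzian_norm h g > ereal C))"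
proof (intro conjI allI impI)
  fix f h g assume "SHU f h g"
  then have holo: "h holomorphic_on unit_disk" "g holomorphic_on unit_disk"
    and sp: "sense_preserving h g"
    and inj: "\<And>\<mu>. cmod \<mu> = 1 \<Longrightarrow> inj_on (\<lambda>z. h z + \<mu> * cnj (g z)) unit_disk"
    by (auto simp: SHU_def class_SH_def canonical_decomposition_def)
  have "schwarzian_norm h g \<le> ereal 6"
  proof (rule schwarzian_norm_le[OF holo sp])
    fix c z :: complex assume "cmod c = 1" "z \<in> unit_disk"
    then show "cmod (schwarzian (\<lambda>w. h w + c * g w) z) * (1 - (cmod z)\<^sup>2)\<^sup>2 \<le> 6"
      using stable_univalent_analytic[OF holo sp inj, of c]
      by (intro Nehari_Kraus holomorphic_intros holo) simp_all
  qed
  then show "schwarzian_norm h g \<le> 6" by simp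
next
  fix f h g assume "SHC f h g"
  then have holo: "h holomorphic_on unit_disk" "g holomorphic_on unit_disk"
    and sp: "sense_preserving h g"
    and inj: "\<And>\<mu>. cmod \<mu> = 1 \<Longrightarrow> inj_on (\<lambda>z. h z + \<mu> * cnj (g z)) unit_disk"
    and conv: "\<And>\<mu>. cmod \<mu> = 1 \<Longrightarrow> convex ((\<lambda>z. h z + \<mu> * cnj (g z)) ` unit_disk)"
    by (auto simp: SHC_def class_SH_def canonical_decomposition_def)
  have "schwarzian_norm h g \<le> ereal 2"
  proof (rule schwarzian_norm_le[OF holo sp])
    fix c z :: complex assume "cmod c = 1" "z \<in> unit_disk"
    then show "cmod (schwarzian (\<lambda>w. h w + c * g w) z) * (1 - (cmod z)\<^sup>2)\<^sup>2 \<le> 2"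
      using stable_univalent_analytic[OF holo sp inj, of c] stable_convex_analytic[OF holo inj conv, of c]
      by (intro Nehari_convex holomorphic_intros holo) simp_all
  qed
  then show "schwarzian_norm h g \<le> 2" by simp
next
  fix C :: real assume "C < 6"
  moreover have "ereal 6 \<le> schwarzian_norm koebe (\<lambda>_. 0)"
    using schwarzian_norm_ge_at_0[of koebe "\<lambda>_. 0"]
    by (simp add: harmonic_schwarzian_analytic koebe_schwarzian)
  ultimately have "ereal C < schwarzian_norm koebe (\<lambda>_. 0)"
    by (meson less_ereal.simps(1) less_le_trans)
  then show "\<exists>f h g. SHU f h g \<and> ereal C < schwarzian_norm h g" using koebe_SHU by blast
next
  fix C :: real assume "C < 2"
  moreover have "ereal 2 \<le> schwarzian_norm strip_map (\<lambda>_. 0)"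
    using schwarzian_norm_ge_at_0[of strip_map "\<lambda>_. 0"]
    by (simp add: harmonic_schwarzian_analytic strip_map_schwarzian)
  ultimately have "ereal C < schwarzian_norm strip_map (\<lambda>_. 0)"
    by (meson less_ereal.simps(1) less_le_trans)
  then show "\<exists>f h g. SHC f h g \<and> ereal C < schwarzian_norm h g" using strip_map_SHC by blast
qed

end
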